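(* Let $\mathcal H$ be a real Hilbert space, let $A\colon\mathcal H\to 2^{\mathcal H}$ be maximally monotone, let $\beta\in\left]0,+\infty\right[$, let $B\colon\mathcal H\to\mathcal H$ be $\beta$-cocoercive, assume that $\operatorname{zer}(A+B)\neq\varnothing$, and let $\overline w\in\operatorname{zer}(A+B)$. Let $(\gamma_n)_{n\in\mathbb N^*}$ be a sequence in $\left]0,+\infty\right[$, let $(\lambda_n)_{n\in\mathbb N^*}$ be a sequence in $[0,1]$, let $(\mathfrak B_n)_{n\in\mathbb N^*}$ be an $\mathcal H$-valued random process with $\mathbb E[\|\mathfrak B_n\|^2]<+\infty$ for every $n\in\mathbb N^*$, let $w_1$ be an $\mathcal H$-valued random variable with $\mathbb E[\|w_1\|^2]<+\infty$, and for every $n\in\mathbb N^*$ set $$z_n=w_n-\gamma_n\mathfrak B_n,\qquad y_n=J_{\gamma_nA}z_n,\qquad w_{n+1}=(1-\lambda_n)w_n+\lambda_ny_n .$$ Let $\mathcal F_n=\sigma(w_1,\ldots,w_n)$. Suppose that the following four conditions hold. (1) For every $n\in\mathbb N^*$, $\mathbb E[\mathfrak B_n\mid\mathcal F_n]=Bw_n$. (2) There exist $(\alpha_n)_{n\in\mathbb N^*}$ in $\left]0,+\infty\right[$ and $\sigma\in\left]0,+\infty\right[$ such that, for every $n\in\mathbb N^*$, $\mathbb E[\|\mathfrak B_n-Bw_n\|^2\mid\mathcal F_n]\le\sigma^2(1+\alpha_n\|Bw_n\|^2)$. (3) There exists $\varepsilon\in\left]0,+\infty\right[$ such that, for every $n\in\mathbb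 N^*$, $\gamma_n\le(2-\varepsilon)\beta/(1+2\sigma^2\alpha_n)$. (4) Setting $\chi_n^2=\lambda_n\gamma_n^2(1+2\alpha_n\|B\overline w\|^2)$, one has $\sum_{n\in\mathbb N^*}\lambda_n\gamma_n=+\infty$ and $\sum_{n\in\mathbb N^*}\chi_n^2<+\infty$. Then the following hold: (i) $(w_n)_{n\in\mathbb N^*}$ is stochastic quasi-Fejér monotone with respect to $\operatorname{zer}(A+B)$. (ii) There exists an integrable random variable $\zeta_{\overline w}$ such that $\|w_n-\overline w\|^2\to\zeta_{\overline w}$ a.s. (iii) If $B$ is uniformly monotone at $\overline w$, then $w_n\to\overline w$ a.s. (iv) If $B$ is strictly monotone at $\overline w$ and weakly continuous, then there exists a measurable event $\Omega_1$ of probability $1$ such that, for every $\omega\in\Omega_1$, there exists a subsequence $(w_{t_n}(\omega))_{n\in\mathbb N^*}$ of $(w_n(\omega))_{n\in\mathbb N^*}$ converging weakly to $\overline w$.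
   Context: All random variables are defined on a fixed probability space; $\mathbb N^*=\mathbb N\setminus\{0\}$; $\mathcal H$ carries its Borel $\sigma$-algebra; $\langle\cdot\mid\cdot\rangle$ and $\|\cdot\|$ are the scalar product and norm of $\mathcal H$; $\sigma(w_1,\dots,w_n)$ is the $\sigma$-algebra generated by $w_1,\dots,w_n$. A random process is a sequence of integrable $\mathcal H$-valued random variables. A set-valued operator $A\colon\mathcal H\to2^{\mathcal H}$ is monotone if $\langle w-y\mid u-v\rangle\ge0$ for all $(w,u),(y,v)$ in its graph $\{(w,u): u\in Aw\}$, and maximally monotone if no monotone operator has a graph properly containing that of $A$. $\operatorname{zer}(A+B)=\{w\in\mathcal H: 0\in Aw+Bw\}$. $J_{\gamma A}=(I+\gamma A)^{-1}$ is the resolvent, a single-valued map $\mathcal H\to\mathcal H$. $B\colon\mathcal H\to\mathcal H$ is $\beta$-cocoercive if $\langle w-y\mid Bw-By\rangle\ge\beta\|Bw-By\|^2$ for all $w,y\in\mathcal H$. $B$ is uniformly monotone at $y$ if there is an increasing function $\phi\colon[0,+\infty[\to[0,+\infty]$ vanishing only at $0$ such that $\langle w-y\mid Bw-By\rangle\ge\phi(\|w-y\|)$ for all $w\in\mathcal H$. $B$ is strictly monotone at $y$ if $\langle w-y\mid Bw-By\rangle>0$ for all $w\ne y$. $B$ is weakly continuous if it is continuous from $\mathcal H$ with the weak topology to $\mathcal H$ with the weak topology. A random process $(w_n)_{n\in\mathbb N^*}$ in $\mathcal H$ is stochastic quasi-Fejér monotone with respect to a nonempty set $S\subset\mathcal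 H$ if $\mathbb E[\|w_1\|^2]<+\infty$ and there exists a summable sequence $(\varepsilon_n)_{n\in\mathbb N^*}$ in $[0,+\infty[$ such that, for every $w\in S$ and every $n\in\mathbb N^*$, $\mathbb E[\|w_{n+1}-w\|^2\mid\sigma(w_1,\ldots,w_n)]\le\|w_n-w\|^2+\varepsilon_n$ a.s. *)

theory Defs
  imports "HOL-Probability.Probability"
begin

section \<open>Set-valued operators on a real Hilbert space\<close>

type_synonym 'h set_operator = "'h \<Rightarrow> 'h set"

definition graph_op :: "'h set_operator \<Rightarrow> ('h \<times> 'h) set" where
  "graph_op A = {(w, u). u \<in> A w}"

definition monotone_op :: "('h::real_inner) set_operator \<Rightarrow> bool" where
  "monotone_op A \<longleftrightarrow>
     (\<forall>(w, u)\<in>graph_op A. \<forall>(y, v)\<in>graph_op A. inner (w - y) (u - v) \<ge> 0)"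

definition maximally_monotone :: "('h::real_inner) set_operator \<Rightarrow> bool" where
  "maximally_monotone A \<longleftrightarrow>
     monotone_op A \<and> \<not> (\<exists>A'. monotone_op A' \<and> graph_op A \<subset> graph_op A')"

definition zer_sum :: "('h::real_inner) set_operator \<Rightarrow> ('h \<Rightarrow> 'h) \<Rightarrow> 'h set" where
  "zer_sum A B = {w. 0 \<in> {u + B w |u. u \<in> A w}}"

text \<open>
  \<open>resolvent \<gamma> A z\<close> is the unique \<open>y\<close> with \<open>z \<in> y + \<gamma> A y\<close>. That it is well defined
  everywhere, for \<open>\<gamma> > 0\<close> and \<open>A\<close> maximally monotone on a Hilbert space, is
  Minty's theorem; it is not built into the definition.
\<close>

definition resolvent :: "real \<Rightarrow> ('h::real_inner) set_operator \<Rightarrow> 'h \<Rightarrow> 'h" where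
  "resolvent \<gamma> A z = (THE y. z \<in> {y + \<gamma> *\<^sub>R u |u. u \<in> A y})"

definition cocoercive :: "real \<Rightarrow> ('h::real_inner \<Rightarrow> 'h) \<Rightarrow> bool" where
  "cocoercive \<beta> B \<longleftrightarrow>
     (\<forall>w y. inner (w - y) (B w - B y) \<ge> \<beta> * (norm (B w - B y))\<^sup>2)"

text \<open>
  Increasing is read in the wide sense (\<open>mono_on\<close>). This is the weaker requirement
  on the modulus, so strictly increasing moduli are covered as well.
\<close>

definition uniformly_monotone_at :: "('h::real_inner \<Rightarrow> 'h) \<Rightarrow> 'h \<Rightarrow> bool" where
  "uniformly_monotone_at B y \<longleftrightarrow>
     (\<exists>\<phi> :: real \<Rightarrow> ereal.
        mono_on {0..} \<phi> \<and>
        (\<forall>t\<ge>0. \<phi> t \<ge> 0) \<and>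
        (\<forall>t\<ge>0. \<phi> t = 0 \<longleftrightarrow> t = 0) \<and>
        (\<forall>w. ereal (inner (w - y) (B w - B y)) \<ge> \<phi> (norm (w - y))))"

definition strictly_monotone_at :: "('h::real_inner \<Rightarrow> 'h) \<Rightarrow> 'h \<Rightarrow> bool" where
  "strictly_monotone_at B y \<longleftrightarrow>
     (\<forall>w. w \<noteq> y \<longrightarrow> inner (w - y) (B w - B y) > 0)"

definition weak_topology :: "('h::real_inner) topology" where
  "weak_topology = topology_generated_by {{x. inner x u \<in> U} |u U. open U}"

definition weakly_continuous :: "('h::real_inner \<Rightarrow> 'h) \<Rightarrow> bool" where
  "weakly_continuous B \<longleftrightarrow> continuous_map weak_topology weak_topology B"

definition weakly_converges :: "(nat \<Rightarrow> 'h::real_inner) \<Rightarrow> 'h \<Rightarrow> bool" where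
  "weakly_converges x l \<longleftrightarrow> limitin weak_topology x l sequentially"

section \<open>Hilbert-space-valued random variables\<close>

text \<open>
  The Hilbert space is not assumed to be separable, whereas the Bochner integral of
  HOL-Analysis requires a second countable type. The notions below are the usual
  ones for arbitrary normed spaces; the two lemmas below show that they reduce to
  \<open>borel_measurable\<close> and \<open>has_bochner_integral\<close> in the separable case.
  As usual in Bochner's theory, a random variable is Borel measurable
  with separable range (strongly measurable): without the latter even sums need not be
  Borel measurable.
\<close>

definition rand_var :: "'a measure \<Rightarrow> ('a \<Rightarrow> 'h::real_normed_vector) \<Rightarrow> bool" where
  "rand_var M f \<longleftrightarrow>
     f \<in> borel_measurable M \<and> (\<exists>D. countable D \<and> f ` space M \<subseteq> closure D)"

lemma rand_var_iff_borel_measurable: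
  fixes f :: "'a \<Rightarrow> 'h::{real_normed_vector, second_countable_topology}"
  shows "rand_var M f \<longleftrightarrow> f \<in> borel_measurable M"
proof -
  obtain D :: "'h set" where D: "countable D" "\<And>X. open X \<Longrightarrow> X \<noteq> {} \<Longrightarrow> \<exists>d\<in>D. d \<in> X"
    using countable_dense_exists[where 'a='h] by blast
  have "closure D = UNIV"
  proof (rule ccontr)
    assume "closure D \<noteq> UNIV"
    then obtain d where "d \<in> D" "d \<in> - closure D"
      using D(2)[of "- closure D"] by auto
    then show False
      using closure_subset by auto
  qed
  with D(1) show ?thesis
    unfolding rand_var_def by auto
qed

definition Bochner_has_integral ::
    "'a measure \<Rightarrow> ('a \<Rightarrow> 'h::real_normed_vector) \<Rightarrow> 'h \<Rightarrow> bool" where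
  "Bochner_has_integral M f x \<longleftrightarrow>
     f \<in> borel_measurable M \<and>
     (\<exists>s. (\<forall>i. Bochner_Integration.simple_bochner_integrable M (s i)) \<and>
          (\<lambda>i. \<integral>\<^sup>+\<omega>. ennreal (norm (f \<omega> - s i \<omega>)) \<partial>M) \<longlonglongrightarrow> 0 \<and>
          (\<lambda>i. Bochner_Integration.simple_bochner_integral M (s i)) \<longlonglongrightarrow> x)"

lemma Bochner_has_integral_iff_has_bochner_integral:
  fixes f :: "'a \<Rightarrow> 'h::{real_normed_vector, second_countable_topology}"
  shows "Bochner_has_integral M f x \<longleftrightarrow> has_bochner_integral M f x"
  unfolding Bochner_has_integral_def has_bochner_integral.simps by auto

definition integrable_rand_var :: "'a measure \<Rightarrow> ('a \<Rightarrow> 'h::real_normed_vector) \<Rightarrow> bool" where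
  "integrable_rand_var M f \<longleftrightarrow> rand_var M f \<and> (\<exists>x. Bochner_has_integral M f x)"

definition square_integrable :: "'a measure \<Rightarrow> ('a \<Rightarrow> 'h::real_normed_vector) \<Rightarrow> bool" where
  "square_integrable M f \<longleftrightarrow> integrable M (\<lambda>\<omega>. (norm (f \<omega>))\<^sup>2)"

text \<open>Sequences are indexed by the positive integers; the entry at \<open>0\<close> is irrelevant.\<close>

definition random_process :: "'a measure \<Rightarrow> (nat \<Rightarrow> 'a \<Rightarrow> 'h::real_normed_vector) \<Rightarrow> bool" where
  "random_process M X \<longleftrightarrow> (\<forall>n\<ge>1. integrable_rand_var M (X n))"

text \<open>\<open>past_algebra M w n\<close> is \<open>\<sigma>(w\<^sub>1, \<dots>, w\<^sub>n)\<close>; only its sets are relevant.\<close>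

definition past_algebra ::
    "'a measure \<Rightarrow> (nat \<Rightarrow> 'a \<Rightarrow> 'h::topological_space) \<Rightarrow> nat \<Rightarrow> 'a measure" where
  "past_algebra M w n =
     sigma (space M) {w i -` U \<inter> space M |i U. 1 \<le> i \<and> i \<le> n \<and> U \<in> sets borel}"

text \<open>\<open>is_cond_exp M F f g\<close>: \<open>g\<close> is a version of the conditional expectation of \<open>f\<close> given \<open>F\<close>.\<close>

definition is_cond_exp ::
    "'a measure \<Rightarrow> 'a measure \<Rightarrow> ('a \<Rightarrow> 'h::real_normed_vector) \<Rightarrow> ('a \<Rightarrow> 'h) \<Rightarrow> bool" where
  "is_cond_exp M F f g \<longleftrightarrow>
     subalgebra M F \<and> integrable_rand_var M f \<and> integrable_rand_var M g \<and> rand_var F g \<and>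
     (\<forall>E\<in>sets F. \<exists>x. Bochner_has_integral M (\<lambda>\<omega>. indicator E \<omega> *\<^sub>R f \<omega>) x \<and>
                     Bochner_has_integral M (\<lambda>\<omega>. indicator E \<omega> *\<^sub>R g \<omega>) x)"

text \<open>
  Conditional expectations of squared norms are taken with \<open>nn_cond_exp\<close>,
  which needs no integrability, so that the bounds below never
  hold through a default value.
\<close>

definition stoch_quasi_Fejer ::
    "'a measure \<Rightarrow> (nat \<Rightarrow> 'a \<Rightarrow> 'h::real_normed_vector) \<Rightarrow> 'h set \<Rightarrow> bool" where
  "stoch_quasi_Fejer M w S \<longleftrightarrow>
     S \<noteq> {} \<and> random_process M w \<and> square_integrable M (w 1) \<and>
     (\<exists>\<epsilon> :: nat \<Rightarrow> real.
        (\<forall>n\<ge>1. \<epsilon> n \<ge> 0) \<and> summable (\<lambda>n. \<epsilon> (Suc n)) \<and>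
        (\<forall>v\<in>S. \<forall>n\<ge>1. AE \<omega> in M.
           nn_cond_exp M (past_algebra M w n) (\<lambda>\<omega>. ennreal ((norm (w (Suc n) \<omega> - v))\<^sup>2)) \<omega>
             \<le> ennreal ((norm (w n \<omega> - v))\<^sup>2 + \<epsilon> n)))"

end

theory Submission
  imports Defs
begin

text \<open>
Let \<open>v\<close> be a zero of \<open>A + B\<close>. It is a fixed point of \<open>x \<mapsto> J (x - \<gamma> B x)\<close> with \<open>J\<close> the
(nonexpansive) resolvent of \<open>\<gamma> A\<close>, so the squared distance of the next iterate to \<open>v\<close> can be
expanded around \<open>w\<^sub>n\<close>. Three things happen in this expansion. The term that is linear in the noise
\<open>BB\<^sub>n - B w\<^sub>n\<close> is paired with a function of \<open>w\<^sub>n\<close> and has mean zero on every event of the past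
(\<open>is_cond_exp_orthogonal\<close>). The term that is quadratic in the noise is controlled by the variance
condition. The remaining second-order term \<open>\<gamma>\<^sup>2 \<parallel>B w\<^sub>n - B v\<parallel>\<^sup>2\<close>, enlarged by the part of the
variance that grows with \<open>B w\<^sub>n\<close>, is absorbed by cocoercivity, because the step sizes stay below
\<open>2 \<beta> / (1 + 2 \<sigma>\<^sup>2 \<alpha>\<^sub>n)\<close> by a fixed factor. Conditionally on the past, in the mean, one is left with

  \<open>\<parallel>w\<^sub>n\<^sub>+\<^sub>1 - v\<parallel>\<^sup>2 \<le> \<parallel>w\<^sub>n - v\<parallel>\<^sup>2 - \<epsilon> \<lambda>\<^sub>n \<gamma>\<^sub>n \<langle>w\<^sub>n - v, B w\<^sub>n - B v\<rangle> + c\<^sub>n\<close>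

with a deterministic summable sequence \<open>c\<close> (\<open>forward_backward_step_expectation_le\<close>). It does not
depend on \<open>v\<close>, since \<open>B\<close> is constant on the set of zeros. Dropping the negative term gives the
quasi-Fejer property. Keeping it, the Robbins-Siegmund argument (\<open>robbins_siegmund\<close>) yields at the
same time that the distances to \<open>wbar\<close> converge almost surely and that the sum of the
\<open>\<lambda>\<^sub>n \<gamma>\<^sub>n \<langle>w\<^sub>n - wbar, B w\<^sub>n - B wbar\<rangle>\<close> is almost surely finite. The weights \<open>\<lambda>\<^sub>n \<gamma>\<^sub>n\<close> are not summable, so
on almost every trajectory the inner products tend to zero along a subsequence. If \<open>B\<close> is uniformly
monotone at \<open>wbar\<close>, this subsequence converges strongly to \<open>wbar\<close>, and the convergence of the distances
carries this over to the whole sequence. If \<open>B\<close> is strictly monotone and weakly continuous,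
cocoercivity makes \<open>B w\<close> converge strongly to \<open>B wbar\<close> along the subsequence; a weak cluster point then
has the same image under \<open>B\<close> as \<open>wbar\<close> and must be \<open>wbar\<close>.

The general theory behind this has three parts. The resolvent is defined everywhere by Minty's
theorem, and bounded sequences have weakly convergent subsequences; both rest on a single fact about
convex sets, \<open>convex_epigraph_envelope_point\<close>. Strongly measurable functions with values in a Hilbert
space that may fail to be separable are approximated by simple functions, which gives the existence of
Bochner integrals and the orthogonality of the noise. Finally, nonnegative supermartingales converge
almost surely because they make finitely many upcrossings of each rational interval.
\<close>

section \<open>Maximally monotone operators and resolvents\<close>

text \<open>
Over the convex set \<open>K\<close> the function \<open>c + \<parallel>q\<parallel>\<^sup>2\<close> is bounded below and strongly convex in \<open>q\<close>, hence the
\<open>q\<close>-components of a minimising sequence form a Cauchy sequence. Their limit \<open>x\<close> need not be attained in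
\<open>K\<close>, but the first-order optimality condition survives the passage to the limit. As the infimum is
nonnegative, it implies the asserted inequality, which can be read as \<open>\<parallel>x - q\<parallel>\<^sup>2 \<le> c + \<parallel>q\<parallel>\<^sup>2\<close>. The lemma thus produces a common
point of a family of balls (Minty) or a representing vector (Riesz) without a compactness argument.
\<close>

lemma convex_epigraph_envelope_point:
  fixes K :: "('h::{real_inner, complete_space} \<times> real) set"
  assumes K: "convex K" "K \<noteq> {}"
    and nonneg: "\<And>q c. (q, c) \<in> K \<Longrightarrow> 0 \<le> c + (norm q)\<^sup>2"
  obtains x where "x \<in> closure (fst ` K)"
    and "\<And>q c. (q, c) \<in> K \<Longrightarrow> (norm x)\<^sup>2 - 2 * inner x q \<le> c"
proof -
  define f :: "'h \<times> real \<Rightarrow> real" where "f = (\<lambda>(q, c). c + (norm q)\<^sup>2)"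
  define s where "s = Inf (f ` K)"
  have fnn: "0 \<le> f a" if "a \<in> K" for a
    using nonneg that by (cases a) (auto simp: f_def)
  have bdd: "bdd_below (f ` K)"
    using fnn by (intro bdd_belowI2[of _ 0]) auto
  have sle: "s \<le> f a" if "a \<in> K" for a
    unfolding s_def using bdd that by (auto intro: cInf_lower)
  have s0: "0 \<le> s"
    unfolding s_def using fnn K(2) by (intro cInf_greatest) auto
  \<comment> \<open>strong convexity, evaluated at a convex combination of two points of \<open>K\<close>\<close>
  have conc: "s \<le> (1 - t) * f a + t * f b - t * (1 - t) * (norm (fst a - fst b))\<^sup>2"
    if "a \<in> K" "b \<in> K" "0 \<le> t" "t \<le> 1" for a b t
  proof -
    have "s \<le> f ((1 - t) *\<^sub>R a + t *\<^sub>R b)"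
      using that K(1) by (intro sle) (auto simp: convex_alt)
    also have "\<dots> = (1 - t) * f a + t * f b - t * (1 - t) * (norm (fst a - fst b))\<^sup>2"
      by (cases a; cases b)
         (simp add: f_def power2_norm_eq_inner inner_add_left inner_add_right inner_diff_left
           inner_diff_right inner_commute algebra_simps)
    finally show ?thesis .
  qed
  have "\<exists>a\<in>K. f a < s + 1 / real (Suc n)" for n
    using cInf_lessD[of "f ` K" "s + 1 / real (Suc n)"] K(2) by (auto simp: s_def)
  then obtain a where a: "\<And>n. a n \<in> K" "\<And>n. f (a n) < s + 1 / real (Suc n)"
    by metis
  have gap: "(norm (fst (a m) - fst (a n)))\<^sup>2 \<le> 4 / real (Suc N)" if "N \<le> m" "N \<le> n" for m n N
  proof -
    have "1 / real (Suc m) \<le> 1 / real (Suc N)" "1 / real (Suc n) \<le> 1 / real (Suc N)"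
      using that by (auto simp: field_simps)
    then show ?thesis
      using conc[OF a(1)[of m] a(1)[of n], of "1/2"] a(2)[of m] a(2)[of n] by simp
  qed
  have "Cauchy (\<lambda>n. fst (a n))"
  proof (rule CauchyI)
    fix e :: real assume e: "0 < e"
    obtain N where "4 / e\<^sup>2 < real N" using reals_Archimedean2 by blast
    then have "4 / e\<^sup>2 < real (Suc N)" by simp
    then have N: "4 / real (Suc N) < e\<^sup>2" using e by (simp add: field_simps del: of_nat_Suc)
    have "norm (fst (a m) - fst (a n)) < e" if "N \<le> m" "N \<le> n" for m n
      using gap[OF that] N e by (intro power2_less_imp_less[of _ e]) auto
    then show "\<exists>N. \<forall>m\<ge>N. \<forall>n\<ge>N. norm (fst (a m) - fst (a n)) < e" by blast
  qed
  then obtain x where x: "(\<lambda>n. fst (a n)) \<longlonglongrightarrow> x"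
    using Cauchy_convergent convergent_def by blast
  have fs: "(\<lambda>n. f (a n)) \<longlonglongrightarrow> s"
  proof (rule tendsto_sandwich[OF _ _ tendsto_const])
    show "(\<lambda>n. s + 1 / real (Suc n)) \<longlonglongrightarrow> s"
      using tendsto_add[OF tendsto_const[of s] LIMSEQ_Suc[OF lim_1_over_n]] by simp
    show "\<forall>\<^sub>F n in sequentially. f (a n) \<le> s + 1 / real (Suc n)"
      using a(2) by (auto intro!: always_eventually less_imp_le)
    show "\<forall>\<^sub>F n in sequentially. s \<le> f (a n)"
      using sle a(1) by (auto intro!: always_eventually)
  qed
  \<comment> \<open>the optimality condition: move from the minimising sequence towards \<open>b\<close> and compare\<close>
  have lim1: "(1 - t) * (norm (x - fst b))\<^sup>2 \<le> f b - s" if b: "b \<in> K" and t: "0 < t" "t < 1" for b t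
  proof -
    have "(\<lambda>n. (1 - t) * f (a n) + t * f b - t * (1 - t) * (norm (fst (a n) - fst b))\<^sup>2)
       \<longlonglongrightarrow> (1 - t) * s + t * f b - t * (1 - t) * (norm (x - fst b))\<^sup>2"
      by (intro tendsto_intros x fs)
    then have "s \<le> (1 - t) * s + t * f b - t * (1 - t) * (norm (x - fst b))\<^sup>2"
      using conc[OF a(1) b] t by (intro LIMSEQ_le_const) auto
    then have "t * ((1 - t) * (norm (x - fst b))\<^sup>2) \<le> t * (f b - s)"
      by (simp add: algebra_simps)
    then show ?thesis using t by simp
  qed
  have lim2: "(norm (x - fst b))\<^sup>2 \<le> f b - s" if b: "b \<in> K" for b
  proof -
    have "((\<lambda>t. (1 - t) * (norm (x - fst b))\<^sup>2) \<longlongrightarrow> (1 - 0) * (norm (x - fst b))\<^sup>2) (at_right (0::real))"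
      by (intro tendsto_intros)
    moreover have "\<forall>\<^sub>F t in at_right (0::real). (1 - t) * (norm (x - fst b))\<^sup>2 \<le> f b - s"
      using lim1[OF b] by (auto simp: eventually_at_right_field intro!: exI[of _ 1])
    ultimately show ?thesis
      using tendsto_upperbound by fastforce
  qed
  show thesis
  proof
    show "x \<in> closure (fst ` K)"
      unfolding closure_sequential using x a(1) by (intro exI[of _ "\<lambda>n. fst (a n)"]) auto
    show "(norm x)\<^sup>2 - 2 * inner x q \<le> c" if "(q, c) \<in> K" for q c
      using lim2[OF that] s0
      by (simp add: f_def power2_norm_eq_inner inner_diff_left inner_diff_right inner_commute algebra_simps)
  qed
qed

text \<open>
The form \<open>c + c' - \<langle>a, u'\<rangle> - \<langle>a', u\<rangle>\<close> is affine in each of its two arguments and nonnegative on pairs of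
points \<open>(a, u, \<langle>a, u\<rangle>)\<close> of the lifted graph, where it equals \<open>\<langle>a - a', u - u'\<rangle>\<close>. So it stays
nonnegative on the convex hull, and on the diagonal it is \<open>2 (c - \<langle>a, u\<rangle>)\<close>.
\<close>

lemma monotone_op_convex_hull:
  assumes pairs: "\<And>a u b v. (a, u) \<in> G \<Longrightarrow> (b, v) \<in> G \<Longrightarrow> 0 \<le> inner (a - b) (u - v)"
    and mem: "(a, u, c) \<in> convex hull ((\<lambda>(a, u). (a, u, inner a u)) ` G)"
  shows "inner a (u::'h::real_inner) \<le> c"
proof -
  let ?S = "(\<lambda>(a, u). (a, u, inner a u)) ` G :: ('h \<times> 'h \<times> real) set"
  define b where "b = (\<lambda>(a::'h, u::'h, c::real) (a', u', c'). c + c' - inner a u' - inner a' u)"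
  have conv: "convex {X. 0 \<le> b X Y}" for Y
  proof -
    obtain a' u' c' where Y: "Y = (a', u', c')" by (cases Y) auto
    have "0 \<le> b (s *\<^sub>R X + t *\<^sub>R X') Y"
      if "0 \<le> b X Y" "0 \<le> b X' Y" "0 \<le> s" "0 \<le> t" "s + t = 1" for X X' s t
    proof -
      have t: "t = 1 - s" using that by simp
      have "b (s *\<^sub>R X + t *\<^sub>R X') Y = s * b X Y + t * b X' Y"
        unfolding t Y b_def
        by (cases X; cases X') (simp add: inner_add_left inner_add_right algebra_simps)
      then show ?thesis using that by simp
    qed
    then show ?thesis by (auto simp: convex_def)
  qed
  have sym: "b X Y = b Y X" for X Y
    by (cases X; cases Y) (simp add: b_def)
  have SS: "0 \<le> b X Y" if XY: "X \<in> ?S" "Y \<in> ?S" for X Y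
  proof -
    obtain a u a' u' where "(a, u) \<in> G" "(a', u') \<in> G" "X = (a, u, inner a u)" "Y = (a', u', inner a' u')"
      using XY by auto
    then show ?thesis
      using pairs[of a u a' u'] by (simp add: b_def inner_diff_left inner_diff_right)
  qed
  have hull: "convex hull ?S \<subseteq> {X. 0 \<le> b X Y}" if "Y \<in> ?S" for Y
    using SS[OF _ that] by (intro hull_minimal conv subsetI CollectI)
  have "0 \<le> b X Y" if "X \<in> ?S" "Y \<in> convex hull ?S" for X Y
    using subsetD[OF hull[OF that(1)] that(2)] by (simp add: sym[of X Y])
  then have "convex hull ?S \<subseteq> {X. 0 \<le> b X Y}" if "Y \<in> convex hull ?S" for Y
    using that by (intro hull_minimal conv subsetI CollectI)
  then have "0 \<le> b (a, u, c) (a, u, c)" using mem by blast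
  then show ?thesis by (simp add: b_def)
qed

lemma monotone_opD:
  "monotone_op A \<Longrightarrow> u \<in> A x \<Longrightarrow> v \<in> A y \<Longrightarrow> 0 \<le> inner (x - y) (u - v)"
  by (auto simp: monotone_op_def graph_op_def)

lemma maximally_monotoneD:
  assumes "maximally_monotone A"
    and "\<And>a v. v \<in> A a \<Longrightarrow> 0 \<le> inner (x - a) (u - v)"
  shows "u \<in> A x"
proof (rule ccontr)
  assume notin: "u \<notin> A x"
  define A' where "A' = A (x := insert u (A x))"
  have g: "graph_op A' = insert (x, u) (graph_op A)"
    unfolding A'_def graph_op_def by (auto split: if_splits)
  have mono: "monotone_op A" using assms(1) by (simp add: maximally_monotone_def)
  have 1: "0 \<le> inner (x - a) (u - v)" "0 \<le> inner (a - x) (v - u)" if "(a, v) \<in> graph_op A" for a v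
    using assms(2)[of v a] that
    by (auto simp: graph_op_def inner_diff_left inner_diff_right algebra_simps)
  have "monotone_op A'"
    using mono 1 unfolding monotone_op_def g by auto
  moreover have "graph_op A \<subset> graph_op A'"
    using notin unfolding g by (auto simp: graph_op_def)
  ultimately show False
    using assms(1) by (auto simp: maximally_monotone_def)
qed

text \<open>
By maximality it is enough to find \<open>x\<close> such that \<open>(z - x) / \<gamma>\<close> is monotonically related at \<open>x\<close> to all
of the graph. With \<open>u = \<gamma> v - z\<close> for \<open>v \<in> A a\<close> this condition reads
\<open>\<parallel>x\<parallel>\<^sup>2 - 2 \<langle>x, (a - u) / 2\<rangle> \<le> \<langle>a, u\<rangle>\<close>, which is the conclusion of \<open>convex_epigraph_envelope_point\<close>.
Its hypothesis holds on the convex hull since there \<open>c + \<parallel>a - u\<parallel>\<^sup>2 / 4 \<ge> \<parallel>a + u\<parallel>\<^sup>2 / 4\<close> by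
\<open>monotone_op_convex_hull\<close>.
\<close>

theorem minty:
  fixes A :: "'h::{real_inner, complete_space} \<Rightarrow> 'h set"
  assumes A: "maximally_monotone A" and \<gamma>: "0 < \<gamma>"
  shows "\<exists>x u. u \<in> A x \<and> z = x + \<gamma> *\<^sub>R u"
proof -
  define G where "G = {(a, \<gamma> *\<^sub>R v - z) |a v. v \<in> A a}"
  define S where "S = (\<lambda>(a, u). (a, u, inner a u)) ` G"
  define L where "L = (\<lambda>(a::'h, u::'h, c::real). ((1/2) *\<^sub>R (a - u), c))"
  define K where "K = L ` (convex hull S)"
  have G: "0 \<le> inner (a - b) (u - v)" if ab: "(a, u) \<in> G" "(b, v) \<in> G" for a u b v
  proof -
    obtain u' v' where *: "u = \<gamma> *\<^sub>R u' - z" "u' \<in> A a" "v = \<gamma> *\<^sub>R v' - z" "v' \<in> A b"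
      using ab unfolding G_def by blast
    have "0 \<le> inner (a - b) (u' - v')"
      using A * by (auto simp: maximally_monotone_def intro: monotone_opD)
    moreover have "inner (a - b) (u - v) = \<gamma> * inner (a - b) (u' - v')"
      unfolding * by (simp add: inner_diff_right algebra_simps)
    ultimately show ?thesis using \<gamma> by simp
  qed
  have convK: "convex K"
    unfolding K_def
  proof (rule convex_linear_image)
    show "linear L"
      by (rule linearI) (auto simp: L_def algebra_simps)
  qed simp
  have nonneg: "0 \<le> c + (norm q)\<^sup>2" if qc: "(q, c) \<in> K" for q c
  proof -
    obtain a u where *: "(a, u, c) \<in> convex hull S" "q = (1/2) *\<^sub>R (a - u)"
      using qc by (auto simp: K_def L_def)
    have "inner a u \<le> c"
      using monotone_op_convex_hull[OF G *(1)[unfolded S_def]] .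
    moreover have "0 \<le> (norm (a + u))\<^sup>2" by simp
    ultimately show ?thesis
      unfolding * by (simp add: power2_norm_eq_inner inner_add_left inner_add_right inner_diff_left
          inner_diff_right inner_commute algebra_simps)
  qed
  obtain x where x: "\<And>q c. (q, c) \<in> K \<Longrightarrow> (norm x)\<^sup>2 - 2 * inner x q \<le> c"
  proof (cases "K = {}")
    case True
    then show ?thesis by (intro that[of 0]) simp
  next
    case False
    show ?thesis
      by (rule convex_epigraph_envelope_point[OF convK False nonneg]) (auto intro: that)
  qed
  have "(1/\<gamma>) *\<^sub>R (z - x) \<in> A x"
  proof (rule maximally_monotoneD[OF A])
    fix a v assume v: "v \<in> A a"
    define u where "u = \<gamma> *\<^sub>R v - z"
    have "(a, u, inner a u) \<in> S"
      unfolding S_def G_def u_def using v by (intro image_eqI[of _ _ "(a, \<gamma> *\<^sub>R v - z)"]) auto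
    then have "((1/2) *\<^sub>R (a - u), inner a u) \<in> K"
      unfolding K_def L_def by (intro image_eqI[of _ _ "(a, u, inner a u)"] hull_inc) auto
    from x[OF this] have "0 \<le> inner (x - a) (- x - u)"
      by (simp add: power2_norm_eq_inner inner_diff_left inner_diff_right inner_commute algebra_simps)
    also have "- x - u = \<gamma> *\<^sub>R ((1/\<gamma>) *\<^sub>R (z - x) - v)"
      using \<gamma> by (simp add: u_def algebra_simps)
    finally show "0 \<le> inner (x - a) ((1/\<gamma>) *\<^sub>R (z - x) - v)"
      using \<gamma> by (simp add: zero_le_mult_iff)
  qed
  then show ?thesis
    using \<gamma> by (intro exI[of _ x] exI[of _ "(1/\<gamma>) *\<^sub>R (z - x)"]) simp
qed

lemma monotone_resolvent_unique:
  assumes "monotone_op A" "0 < \<gamma>" "u \<in> A x" "v \<in> A y" "x + \<gamma> *\<^sub>R u = y + \<gamma> *\<^sub>R v"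
  shows "x = y"
proof -
  have "x - y = \<gamma> *\<^sub>R (v - u)"
    using assms(5) by (simp add: algebra_simps)
  then have "inner (x - y) (x - y) = inner (x - y) (\<gamma> *\<^sub>R (v - u))" by simp
  also have "\<dots> = - \<gamma> * inner (x - y) (u - v)"
    by (simp only: inner_scaleR_right inner_diff_right) (simp add: algebra_simps)
  finally have "inner (x - y) (x - y) = - \<gamma> * inner (x - y) (u - v)" .
  moreover have "0 \<le> inner (x - y) (u - v)"
    using assms by (auto intro: monotone_opD)
  ultimately have "inner (x - y) (x - y) \<le> 0"
    using assms(2) by (simp add: mult_nonneg_nonneg)
  then show ?thesis by (metis eq_iff_diff_eq_0 inner_eq_zero_iff inner_ge_zero order_antisym)
qed

lemma resolvent_eq:
  assumes A: "maximally_monotone A" and \<gamma>: "0 < \<gamma>" and u: "u \<in> A x"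
  shows "resolvent \<gamma> A (x + \<gamma> *\<^sub>R u) = x"
  unfolding resolvent_def
proof (rule the_equality)
  show "y = x" if "x + \<gamma> *\<^sub>R u \<in> {y + \<gamma> *\<^sub>R u |u. u \<in> A y}" for y
    using that monotone_resolvent_unique[OF _ \<gamma>] A u unfolding maximally_monotone_def by blast
qed (use u in auto)

lemma resolvent_nonexpansive:
  fixes A :: "'h::{real_inner, complete_space} \<Rightarrow> 'h set"
  assumes A: "maximally_monotone A" and \<gamma>: "0 < \<gamma>"
  shows "norm (resolvent \<gamma> A z - resolvent \<gamma> A z') \<le> norm (z - z')"
proof -
  obtain x u where x: "u \<in> A x" "z = x + \<gamma> *\<^sub>R u" using minty[OF A \<gamma>] by blast
  obtain y v where y: "v \<in> A y" "z' = y + \<gamma> *\<^sub>R v" using minty[OF A \<gamma>] by blast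
  have r: "resolvent \<gamma> A z = x" "resolvent \<gamma> A z' = y"
    using resolvent_eq[OF A \<gamma>] x y by auto
  have zz: "z - z' = (x - y) + \<gamma> *\<^sub>R (u - v)"
    using x y by (simp add: algebra_simps)
  have "0 \<le> inner (x - y) (u - v)"
    using A x y by (auto simp: maximally_monotone_def intro: monotone_opD)
  then have "0 \<le> 2 * \<gamma> * inner (x - y) (u - v) + \<gamma>\<^sup>2 * (norm (u - v))\<^sup>2"
    using \<gamma> by simp
  also have "\<dots> = (norm (z - z'))\<^sup>2 - (norm (x - y))\<^sup>2"
    unfolding zz power2_norm_eq_inner
    by (simp only: inner_add_left inner_add_right inner_scaleR_left inner_scaleR_right)
       (simp add: inner_commute power2_eq_square algebra_simps)
  finally have "(norm (x - y))\<^sup>2 \<le> (norm (z - z'))\<^sup>2" by simp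
  then show ?thesis unfolding r by (rule power2_le_imp_le) simp
qed

section \<open>Riesz representation and weak sequential compactness\<close>

text \<open>
The preimages of open sets under the functionals \<open>\<lambda>x. inner x u\<close> are a subbasis of the weak topology,
and eventual membership is stable under finite intersections and arbitrary unions.
\<close>

lemma weakly_converges_iff:
  "weakly_converges x l \<longleftrightarrow> (\<forall>u. (\<lambda>n. inner (x n) u) \<longlonglongrightarrow> inner l (u::'h::real_inner))"
proof
  assume w: "weakly_converges x l"
  show "\<forall>u. (\<lambda>n. inner (x n) u) \<longlonglongrightarrow> inner l u"
  proof (intro allI topological_tendstoI)
    fix u :: 'h and S assume "open S" "inner l u \<in> S"
    then have "openin weak_topology {x. inner x u \<in> S}"
      unfolding weak_topology_def by (intro topology_generated_by_Basis) auto
    then show "\<forall>\<^sub>F n in sequentially. inner (x n) u \<in> S"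
      using w \<open>inner l u \<in> S\<close> by (auto simp: weakly_converges_def limitin_def)
  qed
next
  assume lim: "\<forall>u. (\<lambda>n. inner (x n) u) \<longlonglongrightarrow> inner l u"
  have "\<forall>\<^sub>F n in sequentially. x n \<in> U"
    if "generate_topology_on {{x. inner x u \<in> U} |u U. open U} U" "l \<in> U" for U
    using that
  proof induction
    case (UN K)
    then obtain k where "k \<in> K" "l \<in> k" by auto
    with UN have "\<forall>\<^sub>F n in sequentially. x n \<in> k" by auto
    then show ?case by eventually_elim (use \<open>k \<in> K\<close> in auto)
  next
    case (Basis s)
    then obtain u U where "s = {x. inner x u \<in> U}" "open U" by auto
    then show ?case using lim Basis topological_tendstoD[of "\<lambda>n. inner (x n) u" "inner l u"] by auto
  qed (auto intro: eventually_conj)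
  moreover have "l \<in> topspace weak_topology"
  proof -
    have "openin weak_topology {x. inner x (0::'h) \<in> UNIV}"
      unfolding weak_topology_def by (intro topology_generated_by_Basis) auto
    then show ?thesis using openin_subset by fastforce
  qed
  ultimately show "weakly_converges x l"
    by (auto simp: weakly_converges_def limitin_def weak_topology_def openin_topology_generated_by_iff)
qed

text \<open>
The representing vector minimises \<open>\<parallel>u\<parallel>\<^sup>2 - 2 l u\<close>. Adding \<open>C\<^sup>2\<close> makes this at least
\<open>(C - \<parallel>u\<parallel>)\<^sup>2\<close> and brings it into the form required by \<open>convex_epigraph_envelope_point\<close>; as \<open>L\<close> is a
subspace, the resulting inequality can only hold if the linear terms agree. For \<open>l = inner u\<close> the
vector \<open>x\<close> is the orthogonal projection of \<open>u\<close> onto the closure of \<open>L\<close>.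
\<close>

lemma riesz_subspace:
  fixes L :: "'h::{real_inner, complete_space} set"
  assumes L: "subspace L"
    and add: "\<And>u v. u \<in> L \<Longrightarrow> v \<in> L \<Longrightarrow> l (u + v) = l u + l v"
    and scale: "\<And>u t. u \<in> L \<Longrightarrow> l (t *\<^sub>R u) = t * l u"
    and bound: "\<And>u. u \<in> L \<Longrightarrow> \<bar>l u\<bar> \<le> C * norm u"
  obtains x where "x \<in> closure L" "\<And>u. u \<in> L \<Longrightarrow> inner x u = l u"
proof -
  define K where "K = (\<lambda>u. (u, C\<^sup>2 - 2 * l u)) ` L"
  have L0: "0 \<in> L" using L by (rule subspace_0)
  have convK: "convex K"
    unfolding convex_def
  proof (intro ballI allI impI)
    fix X Y and s t :: real
    assume h: "X \<in> K" "Y \<in> K" "0 \<le> s" "0 \<le> t" "s + t = 1"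
    then obtain u v where *: "X = (u, C\<^sup>2 - 2 * l u)" "Y = (v, C\<^sup>2 - 2 * l v)" "u \<in> L" "v \<in> L"
      by (auto simp: K_def)
    have t: "t = 1 - s" using h by simp
    have mem: "s *\<^sub>R u \<in> L" "t *\<^sub>R v \<in> L" "s *\<^sub>R u + t *\<^sub>R v \<in> L"
      using * L by (auto simp: subspace_def)
    have "l (s *\<^sub>R u + t *\<^sub>R v) = s * l u + t * l v"
      using add[OF mem(1,2)] scale * by simp
    then have "s *\<^sub>R X + t *\<^sub>R Y = (s *\<^sub>R u + t *\<^sub>R v, C\<^sup>2 - 2 * l (s *\<^sub>R u + t *\<^sub>R v))"
      unfolding * t by (simp add: algebra_simps)
    then show "s *\<^sub>R X + t *\<^sub>R Y \<in> K" using mem by (auto simp: K_def)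
  qed
  have nonneg: "0 \<le> c + (norm q)\<^sup>2" if "(q, c) \<in> K" for q c
  proof -
    have q: "q \<in> L" "c = C\<^sup>2 - 2 * l q" using that by (auto simp: K_def)
    have "0 \<le> (C - norm q)\<^sup>2" by simp
    then show ?thesis using bound[OF q(1)] unfolding q by (simp add: power2_eq_square algebra_simps)
  qed
  have "K \<noteq> {}" using L0 by (auto simp: K_def)
  obtain x where
    x: "x \<in> closure (fst ` K)" "\<And>q c. (q, c) \<in> K \<Longrightarrow> (norm x)\<^sup>2 - 2 * inner x q \<le> c"
    by (rule convex_epigraph_envelope_point[OF convK \<open>K \<noteq> {}\<close> nonneg]) (assumption, rule that)
  have fst: "fst ` K = L" by (force simp: K_def)
  show thesis
  proof
    show "x \<in> closure L" using x(1) fst by simp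
    fix u assume u: "u \<in> L"
    show "inner x u = l u"
    proof (rule ccontr)
      assume ne: "inner x u \<noteq> l u"
      define d where "d = l u - inner x u"
      \<comment> \<open>a multiple of \<open>u\<close> chosen so large that the bound fails by one\<close>
      define t where "t = (C\<^sup>2 - (norm x)\<^sup>2 + 1) / (2 * d)"
      have "t *\<^sub>R u \<in> L" using u L by (auto simp: subspace_def)
      then have "(norm x)\<^sup>2 - 2 * inner x (t *\<^sub>R u) \<le> C\<^sup>2 - 2 * l (t *\<^sub>R u)"
        by (intro x(2)) (auto simp: K_def)
      then have "2 * d * t \<le> C\<^sup>2 - (norm x)\<^sup>2"
        using scale[OF u] by (simp add: d_def algebra_simps)
      then show False using ne by (simp add: t_def d_def)
    qed
  qed
qed

lemma convergent_inner_closure: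
  fixes x :: "nat \<Rightarrow> 'h::real_inner"
  assumes bound: "\<And>n. norm (x n) \<le> C"
    and conv: "\<And>u. u \<in> L \<Longrightarrow> convergent (\<lambda>n. inner (x n) u)"
    and p: "p \<in> closure L"
  shows "convergent (\<lambda>n. inner (x n) p)"
proof -
  have C: "0 \<le> C" using bound[of 0] norm_ge_zero order_trans by blast
  have "Cauchy (\<lambda>n. inner (x n) p)"
  proof (rule metric_CauchyI)
    fix e :: real assume e: "0 < e"
    then have "0 < e / (3 * (C + 1))" using C by simp
    then obtain u where u: "u \<in> L" "dist u p < e / (3 * (C + 1))"
      using p by (meson closure_approachable)
    have close: "\<bar>inner (x n) p - inner (x n) u\<bar> < e / 3" for n
    proof -
      have "\<bar>inner (x n) p - inner (x n) u\<bar> \<le> norm (x n) * norm (p - u)"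
        by (metis Cauchy_Schwarz_ineq2 inner_diff_right)
      also have "\<dots> \<le> (C + 1) * norm (p - u)"
        using bound[of n] by (intro mult_right_mono) auto
      also have "\<dots> < e / 3"
        using u(2) C by (simp add: dist_norm norm_minus_commute field_simps)
      finally show ?thesis .
    qed
    obtain N where N: "\<And>m n. N \<le> m \<Longrightarrow> N \<le> n \<Longrightarrow> dist (inner (x m) u) (inner (x n) u) < e / 3"
      using convergent_Cauchy[OF conv[OF u(1)]] e by (meson metric_CauchyD zero_less_divide_iff zero_less_numeral)
    show "\<exists>M. \<forall>m\<ge>M. \<forall>n\<ge>M. dist (inner (x m) p) (inner (x n) p) < e"
    proof (intro exI[of _ N] allI impI)
      fix m n assume "N \<le> m" "N \<le> n"
      from N[OF this] close[of m] close[of n]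
      show "dist (inner (x m) p) (inner (x n) p) < e"
        unfolding dist_real_def by linarith
    qed
  qed
  then show ?thesis by (simp add: Cauchy_convergent_iff)
qed

text \<open>
All inner products \<open>\<langle>x\<^sub>n, x\<^sub>m\<rangle>\<close> lie in a fixed compact interval, so by compactness of a countable product
of intervals some subsequence makes them converge in \<open>n\<close> for every \<open>m\<close>. Convergence extends to
the closed span of the sequence and then to every \<open>u\<close>, which may be replaced by its projection onto
that closed span. The limit functional is represented by a vector.
\<close>

lemma bounded_imp_weakly_convergent_subsequence:
  fixes x :: "nat \<Rightarrow> 'h::{real_inner, complete_space}"
  assumes bound: "\<And>n. norm (x n) \<le> C"
  obtains r l where "strict_mono r" "weakly_converges (\<lambda>n. x (r n)) l"
proof -
  have C: "0 \<le> C" using bound[of 0] norm_ge_zero order_trans by blast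
  define g where "g n = (\<lambda>m. inner (x n) (x m))" for n
  define Q :: "(nat \<Rightarrow> real) set" where "Q = PiE UNIV (\<lambda>_. {- C\<^sup>2 .. C\<^sup>2})"
  have "compact Q"
    unfolding Q_def compactin_euclidean_iff[symmetric] euclidean_product_topology[symmetric] compactin_PiE
    by (simp add: compactin_euclidean_iff)
  have "\<bar>inner (x n) (x m)\<bar> \<le> C\<^sup>2" for n m
    using Cauchy_Schwarz_ineq2[of "x n" "x m"] mult_mono[OF bound[of n] bound[of m] C]
    by (simp add: power2_eq_square)
  then have "g n \<in> Q" for n
    by (auto simp: Q_def g_def abs_le_iff minus_le_iff)
  then obtain h r where r: "strict_mono r" "(g \<circ> r) \<longlonglongrightarrow> h"
    using \<open>compact Q\<close> by (metis compact_imp_seq_compact seq_compactE)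
  define y where "y n = x (r n)" for n
  have yb: "norm (y n) \<le> C" for n by (simp add: y_def bound)
  define L where "L = span (range x)"
  have conv_x: "convergent (\<lambda>n. inner (y n) (x m))" for m
  proof -
    have "(\<lambda>n. (g \<circ> r) n m) \<longlonglongrightarrow> h m"
      using continuous_on_tendsto_compose[OF
          continuous_on_product_then_coordinatewise[OF continuous_on_id, of UNIV m] r(2)]
      by simp
    then show ?thesis by (auto simp: convergent_def g_def y_def)
  qed
  have conv_L: "convergent (\<lambda>n. inner (y n) u)" if "u \<in> L" for u
    using that unfolding L_def
  proof (induction rule: span_induct_alt)
    case base
    then show ?case by (simp add: convergent_const)
  next
    case (step c a b)
    then obtain m where "a = x m" by auto
    then show ?case using step conv_x[of m]
      by (auto simp: inner_add_right intro!: convergent_add convergent_mult convergent_const)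
  qed
  have conv: "convergent (\<lambda>n. inner (y n) u)" for u
  proof -
    have "subspace L" by (simp add: L_def)
    then obtain p where p: "p \<in> closure L" "\<And>v. v \<in> L \<Longrightarrow> inner p v = inner u v"
    proof (rule riesz_subspace[where l = "inner u" and C = "norm u"])
    qed (auto simp: inner_add_right Cauchy_Schwarz_ineq2)
    have "inner (y n) p = inner (y n) u" for n
      using p(2)[of "y n"] by (simp add: y_def L_def span_base inner_commute)
    then show ?thesis
      using convergent_inner_closure[OF yb conv_L p(1)] by simp
  qed
  define l where "l u = lim (\<lambda>n. inner (y n) u)" for u
  have l: "(\<lambda>n. inner (y n) u) \<longlonglongrightarrow> l u" for u
    using conv by (simp add: l_def convergent_LIMSEQ_iff)
  obtain w where "\<And>u. u \<in> UNIV \<Longrightarrow> inner w u = l u"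
  proof (rule riesz_subspace[where l = l and C = C and L = UNIV])
    show "l (u + v) = l u + l v" for u v
      using tendsto_add[OF l[of u] l[of v]] l[of "u + v"]
      by (intro LIMSEQ_unique[OF l]) (simp add: inner_add_right)
    show "l (t *\<^sub>R u) = t * l u" for u t
      using tendsto_mult_left[OF l[of u], of t] by (intro LIMSEQ_unique[OF l]) simp
    show "\<bar>l u\<bar> \<le> C * norm u" for u
    proof (rule LIMSEQ_le_const2[OF tendsto_rabs[OF l]])
      have "\<bar>inner (y n) u\<bar> \<le> C * norm u" for n
        using Cauchy_Schwarz_ineq2[of "y n" u] mult_right_mono[OF yb[of n] norm_ge_zero[of u]] by linarith
      then show "\<exists>N. \<forall>n\<ge>N. \<bar>inner (y n) u\<bar> \<le> C * norm u" by blast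
    qed
  qed auto
  then have "weakly_converges (\<lambda>n. x (r n)) w"
    using l by (simp add: weakly_converges_iff y_def)
  with r(1) show thesis by (rule that)
qed

section \<open>Strongly measurable random variables\<close>

lemma rand_var_measurable: "rand_var M f \<Longrightarrow> f \<in> borel_measurable M"
  by (simp add: rand_var_def)

lemma rand_var_continuous_on:
  assumes f: "rand_var M f" and h: "continuous_on UNIV h"
  shows "rand_var M (\<lambda>\<omega>. h (f \<omega>))"
proof -
  obtain D where D: "countable D" "f ` space M \<subseteq> closure D"
    using f by (auto simp: rand_var_def)
  have "h ` closure D \<subseteq> closure (h ` D)"
    using h by (intro image_closure_subset) (auto intro: continuous_on_subset closure_subset[THEN subsetD])
  then have "(\<lambda>\<omega>. h (f \<omega>)) ` space M \<subseteq> closure (h ` D)" using D by auto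
  moreover have "(\<lambda>\<omega>. h (f \<omega>)) \<in> borel_measurable M"
    using measurable_compose[OF rand_var_measurable[OF f] borel_measurable_continuous_onI[OF h]] .
  ultimately show ?thesis
    using D(1) by (auto simp: rand_var_def)
qed

text \<open>
This is where the separable ranges are needed: the Borel sets of a product of nonseparable spaces
may be more than those generated by rectangles. Over the closures of the countable sets \<open>D\<close> and \<open>E\<close> an
open set coincides with a countable union of products of balls centred in \<open>D\<close> and in \<open>E\<close>.
\<close>

lemma rand_var_Pair:
  assumes f: "rand_var M f" and g: "rand_var M g"
  shows "rand_var M (\<lambda>\<omega>. (f \<omega>, g \<omega>))"
proof -
  obtain D where D: "countable D" "f ` space M \<subseteq> closure D"
    using f by (auto simp: rand_var_def)
  obtain E where E: "countable E" "g ` space M \<subseteq> closure E"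
    using g by (auto simp: rand_var_def)
  have "(\<lambda>\<omega>. (f \<omega>, g \<omega>)) \<in> borel_measurable M"
  proof (rule borel_measurableI)
    fix U :: "('b \<times> 'c) set" assume U: "open U"
    define I where "I = {(d, e, n :: nat). d \<in> D \<and> e \<in> E \<and>
        ball d (1 / Suc n) \<times> ball e (1 / Suc n) \<subseteq> U}"
    define R where "R = (\<lambda>(d, e, n :: nat).
        (f -` ball d (1 / Suc n) \<inter> space M) \<inter> (g -` ball e (1 / Suc n) \<inter> space M))"
    have "I \<subseteq> D \<times> E \<times> UNIV" by (auto simp: I_def)
    then have I: "countable I"
      using D(1) E(1) by (rule_tac countable_subset) auto
    have "R i \<in> sets M" for i
      using measurable_sets[OF rand_var_measurable[OF f]] measurable_sets[OF rand_var_measurable[OF g]]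
      by (cases i) (auto simp: R_def)
    then have "(\<Union>i\<in>I. R i) \<in> sets M"
      using I by (intro sets.countable_UN') auto
    moreover have "(\<lambda>\<omega>. (f \<omega>, g \<omega>)) -` U \<inter> space M = (\<Union>i\<in>I. R i)"
    proof
      show "(\<Union>i\<in>I. R i) \<subseteq> (\<lambda>\<omega>. (f \<omega>, g \<omega>)) -` U \<inter> space M"
        unfolding I_def R_def by fastforce
      show "(\<lambda>\<omega>. (f \<omega>, g \<omega>)) -` U \<inter> space M \<subseteq> (\<Union>i\<in>I. R i)"
      proof
        fix \<omega> assume "\<omega> \<in> (\<lambda>\<omega>. (f \<omega>, g \<omega>)) -` U \<inter> space M"
        then have \<omega>: "(f \<omega>, g \<omega>) \<in> U" "\<omega> \<in> space M" by auto
        obtain P Q where PQ: "open P" "open Q" "f \<omega> \<in> P" "g \<omega> \<in> Q" "P \<times> Q \<subseteq> U"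
          by (rule open_prod_elim[OF U \<omega>(1)]) auto
        obtain r1 where r1: "0 < r1" "ball (f \<omega>) r1 \<subseteq> P" using PQ by (meson openE)
        obtain r2 where r2: "0 < r2" "ball (g \<omega>) r2 \<subseteq> Q" using PQ by (meson openE)
        obtain n where n: "1 / real (Suc n) < min r1 r2 / 2"
          using nat_approx_posE[of "min r1 r2 / 2"] r1 r2 by auto
        obtain d where d: "d \<in> D" "dist d (f \<omega>) < 1 / real (Suc n)"
          using D(2) \<omega>(2) closure_approachable[of "f \<omega>" D]
          by (metis image_subset_iff of_nat_0_less_iff zero_less_Suc zero_less_divide_1_iff)
        obtain e where e: "e \<in> E" "dist e (g \<omega>) < 1 / real (Suc n)"
          using E(2) \<omega>(2) closure_approachable[of "g \<omega>" E]
          by (metis image_subset_iff of_nat_0_less_iff zero_less_Suc zero_less_divide_1_iff)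
        have "ball d (1 / Suc n) \<subseteq> ball (f \<omega>) r1"
        proof
          fix x assume "x \<in> ball d (1 / Suc n)"
          then show "x \<in> ball (f \<omega>) r1"
            using d(2) n dist_triangle[of "f \<omega>" x d] by (simp add: dist_commute)
        qed
        moreover have "ball e (1 / Suc n) \<subseteq> ball (g \<omega>) r2"
        proof
          fix x assume "x \<in> ball e (1 / Suc n)"
          then show "x \<in> ball (g \<omega>) r2"
            using e(2) n dist_triangle[of "g \<omega>" x e] by (simp add: dist_commute)
        qed
        ultimately have "(d, e, n) \<in> I"
          unfolding I_def using d e PQ(5) r1(2) r2(2) by blast
        moreover have "\<omega> \<in> R (d, e, n)"
          using d e \<omega>(2) by (simp add: R_def)
        ultimately show "\<omega> \<in> (\<Union>i\<in>I. R i)" by blast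
      qed
    qed
    ultimately show "(\<lambda>\<omega>. (f \<omega>, g \<omega>)) -` U \<inter> space M \<in> sets M" by simp
  qed
  moreover have "(\<lambda>\<omega>. (f \<omega>, g \<omega>)) ` space M \<subseteq> closure (D \<times> E)"
    using D E by (auto simp: closure_Times)
  ultimately show ?thesis
    using D(1) E(1) by (auto simp: rand_var_def)
qed

lemma rand_var_continuous_on2:
  assumes "rand_var M f" "rand_var M g" "continuous_on UNIV (\<lambda>p. h (fst p) (snd p))"
  shows "rand_var M (\<lambda>\<omega>. h (f \<omega>) (g \<omega>))"
  using rand_var_continuous_on[OF rand_var_Pair[OF assms(1,2)] assms(3)] by simp

lemma rand_var_const: "rand_var M (\<lambda>_. c)"
  unfolding rand_var_def by (auto intro!: exI[of _ "{c}"])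

lemma rand_var_diff: "rand_var M f \<Longrightarrow> rand_var M g \<Longrightarrow> rand_var M (\<lambda>\<omega>. f \<omega> - g \<omega>)"
  by (erule (1) rand_var_continuous_on2[where h = "(-)"]) (intro continuous_intros)

lemma rand_var_add: "rand_var M f \<Longrightarrow> rand_var M g \<Longrightarrow> rand_var M (\<lambda>\<omega>. f \<omega> + g \<omega>)"
  by (erule (1) rand_var_continuous_on2[where h = "(+)"]) (intro continuous_intros)

lemma rand_var_scaleR: "rand_var M f \<Longrightarrow> rand_var M (\<lambda>\<omega>. c *\<^sub>R f \<omega>)"
  by (erule rand_var_continuous_on[where h = "\<lambda>x. c *\<^sub>R x"]) (intro continuous_intros)

lemma rand_var_indicator_scaleR:
  assumes "E \<in> sets M" "rand_var M f"
  shows "rand_var M (\<lambda>\<omega>. indicator E \<omega> *\<^sub>R f \<omega>)"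
proof -
  have "rand_var M (indicator E :: _ \<Rightarrow> real)"
    using assms(1) by (simp add: rand_var_iff_borel_measurable)
  then show ?thesis
    using assms(2) by (rule rand_var_continuous_on2[where h = "(*\<^sub>R)"]) (intro continuous_intros)
qed

lemma rand_var_inner_measurable:
  fixes f g :: "'a \<Rightarrow> 'h::real_inner"
  assumes "rand_var M f" "rand_var M g"
  shows "(\<lambda>\<omega>. inner (f \<omega>) (g \<omega>)) \<in> borel_measurable M"
  by (rule rand_var_measurable[OF rand_var_continuous_on2[where h = inner, OF assms]])
     (intro continuous_intros)

lemma rand_var_norm_measurable:
  assumes "rand_var M f"
  shows "(\<lambda>\<omega>. norm (f \<omega>)) \<in> borel_measurable M"
  by (rule rand_var_measurable[OF rand_var_continuous_on[where h = norm, OF assms]])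
     (intro continuous_intros)

lemma rand_var_from_subalgebra: "subalgebra M F \<Longrightarrow> rand_var F f \<Longrightarrow> rand_var M f"
  unfolding rand_var_def using measurable_from_subalg by (metis subalgebra_def)

lemma rand_var_cong: "(\<And>\<omega>. \<omega> \<in> space M \<Longrightarrow> f \<omega> = g \<omega>) \<Longrightarrow> rand_var M f \<longleftrightarrow> rand_var M g"
  unfolding rand_var_def by (intro conj_cong measurable_cong) (auto simp: image_def)

lemma simple_function_rand_var:
  assumes "simple_function M f"
  shows "rand_var M f"
  unfolding rand_var_def
proof
  show "f \<in> borel_measurable M"
    using assms by (rule borel_measurable_simple_function)
  show "\<exists>D. countable D \<and> f ` space M \<subseteq> closure D"
    using assms closure_subset[of "f ` space M"]
    by (intro exI[of _ "f ` space M"]) (auto simp: simple_function_def intro: countable_finite)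
qed

text \<open>
\<open>s i \<omega>\<close> is a point nearest to \<open>f \<omega>\<close> among the first \<open>i + 1\<close> points of an enumeration of a countable
set whose closure contains the range of \<open>f\<close>. Starting the enumeration with \<open>0\<close> yields the uniform bound
on the error, which serves as the dominating function in limits of integrals.
\<close>

lemma rand_var_simple_approximation:
  fixes f :: "'a \<Rightarrow> 'h::real_normed_vector"
  assumes f: "rand_var M f"
  obtains s where "\<And>i. simple_function M (s i)"
    and "\<And>\<omega>. \<omega> \<in> space M \<Longrightarrow> (\<lambda>i. s i \<omega>) \<longlonglongrightarrow> f \<omega>"
    and "\<And>i \<omega>. norm (f \<omega> - s i \<omega>) \<le> norm (f \<omega>)"
proof -
  obtain D where D: "countable D" "f ` space M \<subseteq> closure D"
    using f by (auto simp: rand_var_def)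
  define e where "e n = (case n of 0 \<Rightarrow> 0 | Suc m \<Rightarrow> from_nat_into D m)" for n
  have e_surj: "\<exists>n. e n = d" if d: "d \<in> D" for d
  proof -
    obtain m where "from_nat_into D m = d" using from_nat_into_surj[OF D(1) d] by blast
    then show ?thesis by (intro exI[of _ "Suc m"]) (simp add: e_def)
  qed
  define best where "best i \<omega> k \<longleftrightarrow> k \<le> i \<and> (\<forall>j\<le>i. dist (f \<omega>) (e k) \<le> dist (f \<omega>) (e j))" for i \<omega> and k :: nat
  define idx where "idx i \<omega> = (LEAST k. best i \<omega> k)" for i \<omega>
  define s where "s i \<omega> = e (idx i \<omega>)" for i \<omega>
  have ex: "\<exists>k. best i \<omega> k" for i \<omega>
  proof -
    have "Min ((\<lambda>k. dist (f \<omega>) (e k)) ` {..i}) \<in> (\<lambda>k. dist (f \<omega>) (e k)) ` {..i}"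
      by (intro Min_in) auto
    then obtain k where k: "k \<le> i" "dist (f \<omega>) (e k) = Min ((\<lambda>k. dist (f \<omega>) (e k)) ` {..i})" by force
    then show ?thesis unfolding best_def k(2) by (intro exI[of _ k]) (auto simp: k)
  qed
  have best: "best i \<omega> (idx i \<omega>)" for i \<omega>
    unfolding idx_def using ex by (rule LeastI_ex)
  have [measurable]: "(\<lambda>\<omega>. dist (f \<omega>) c) \<in> borel_measurable M" for c
    by (rule measurable_compose[OF rand_var_measurable[OF f]])
       (intro borel_measurable_continuous_onI continuous_intros)
  have idx [measurable]: "idx i \<in> measurable M (count_space UNIV)" for i
    unfolding idx_def best_def by measurable
  show thesis
  proof
    show "simple_function M (s i)" for i
      unfolding simple_function_def
    proof (intro conjI ballI)
      have "s i ` space M \<subseteq> e ` {..i}" using best by (auto simp: s_def best_def)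
      then show "finite (s i ` space M)" by (rule finite_subset) simp
      show "s i -` {x} \<inter> space M \<in> sets M" for x
        using measurable_sets[OF idx[of i], of "{k. e k = x}"] by (simp add: s_def vimage_def)
    qed
    show "norm (f \<omega> - s i \<omega>) \<le> norm (f \<omega>)" for i \<omega>
      using best[of i \<omega>] unfolding best_def s_def by (auto simp: dist_norm e_def dest: spec[of _ 0])
    show "(\<lambda>i. s i \<omega>) \<longlonglongrightarrow> f \<omega>" if \<omega>: "\<omega> \<in> space M" for \<omega>
    proof (rule metric_LIMSEQ_I)
      fix r :: real assume "0 < r"
      then obtain d where d: "d \<in> D" "dist d (f \<omega>) < r"
        using D(2) \<omega> closure_approachable[of "f \<omega>" D] by blast
      obtain j where "e j = d" using e_surj d by blast
      then have "dist (s i \<omega>) (f \<omega>) < r" if "j \<le> i" for i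
        using best[of i \<omega>] d(2) that unfolding best_def s_def by (metis dist_commute order_le_less_trans)
      then show "\<exists>N. \<forall>n\<ge>N. dist (s n \<omega>) (f \<omega>) < r" by blast
    qed
  qed
qed

lemma nn_integral_norm_diff_simple_approximation:
  fixes f :: "'a \<Rightarrow> 'h::real_normed_vector"
  assumes f: "rand_var M f" and fin: "(\<integral>\<^sup>+\<omega>. norm (f \<omega>) \<partial>M) < \<infinity>"
    and s: "\<And>i. simple_function M (s i)" "\<And>\<omega>. \<omega> \<in> space M \<Longrightarrow> (\<lambda>i. s i \<omega>) \<longlonglongrightarrow> f \<omega>"
      "\<And>i \<omega>. norm (f \<omega> - s i \<omega>) \<le> norm (f \<omega>)"
  shows "(\<lambda>i. \<integral>\<^sup>+\<omega>. norm (f \<omega> - s i \<omega>) \<partial>M) \<longlonglongrightarrow> 0"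
proof -
  have [measurable]: "(\<lambda>\<omega>. norm (f \<omega> - s i \<omega>)) \<in> borel_measurable M" for i
    by (intro rand_var_norm_measurable rand_var_diff f simple_function_rand_var s)
  have [measurable]: "(\<lambda>\<omega>. norm (f \<omega>)) \<in> borel_measurable M"
    by (intro rand_var_norm_measurable f)
  have "(\<lambda>i. \<integral>\<^sup>+\<omega>. norm (f \<omega> - s i \<omega>) \<partial>M) \<longlonglongrightarrow> (\<integral>\<^sup>+\<omega>. 0 \<partial>M)"
  proof (rule nn_integral_dominated_convergence[where w = "\<lambda>\<omega>. norm (f \<omega>)"])
    show "AE \<omega> in M. (\<lambda>i. ennreal (norm (f \<omega> - s i \<omega>))) \<longlonglongrightarrow> 0"
    proof (rule AE_I2)
      fix \<omega> assume "\<omega> \<in> space M"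
      then have "(\<lambda>i. norm (f \<omega> - s i \<omega>)) \<longlonglongrightarrow> norm (f \<omega> - f \<omega>)"
        by (intro tendsto_intros s)
      then show "(\<lambda>i. ennreal (norm (f \<omega> - s i \<omega>))) \<longlonglongrightarrow> 0"
        using tendsto_ennrealI by fastforce
    qed
  qed (use fin s(3) in auto)
  then show ?thesis by simp
qed

lemma Bochner_integral_exists:
  fixes f :: "'a \<Rightarrow> 'h::{real_normed_vector, complete_space}"
  assumes f: "rand_var M f" and fin: "(\<integral>\<^sup>+\<omega>. norm (f \<omega>) \<partial>M) < \<infinity>"
  shows "integrable_rand_var M f"
proof -
  obtain s where s: "\<And>i. simple_function M (s i)" "\<And>\<omega>. \<omega> \<in> space M \<Longrightarrow> (\<lambda>i. s i \<omega>) \<longlonglongrightarrow> f \<omega>"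
      "\<And>i \<omega>. norm (f \<omega> - s i \<omega>) \<le> norm (f \<omega>)"
    using rand_var_simple_approximation[OF f] by metis
  let ?I = "\<lambda>i. Bochner_Integration.simple_bochner_integral M (s i)"
  let ?d = "\<lambda>i. \<integral>\<^sup>+\<omega>. norm (f \<omega> - s i \<omega>) \<partial>M"
  note d0 = nn_integral_norm_diff_simple_approximation[OF f fin s]
  have [measurable]: "(\<lambda>\<omega>. norm (f \<omega> - s i \<omega>)) \<in> borel_measurable M" for i
    by (intro rand_var_norm_measurable rand_var_diff f simple_function_rand_var s)
  have [measurable]: "(\<lambda>\<omega>. norm (f \<omega>)) \<in> borel_measurable M"
    by (intro rand_var_norm_measurable f)
  have sbi: "Bochner_Integration.simple_bochner_integrable M (s i)" for i
  proof (rule simple_bochner_integrableI_bounded[OF s(1)])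
    have "(\<integral>\<^sup>+\<omega>. norm (s i \<omega>) \<partial>M) \<le> (\<integral>\<^sup>+\<omega>. ennreal 2 * norm (f \<omega>) \<partial>M)"
    proof (intro nn_integral_mono)
      fix \<omega>
      have "norm (s i \<omega>) \<le> 2 * norm (f \<omega>)"
        using s(3)[of \<omega> i] norm_triangle_ineq3[of "s i \<omega>" "f \<omega>"] by (simp add: norm_minus_commute)
      then show "ennreal (norm (s i \<omega>)) \<le> ennreal 2 * ennreal (norm (f \<omega>))"
        by (subst ennreal_mult[symmetric]) (auto intro: ennreal_leI)
    qed
    also have "\<dots> = ennreal 2 * (\<integral>\<^sup>+\<omega>. norm (f \<omega>) \<partial>M)"
      by (rule nn_integral_cmult) measurable
    also have "\<dots> < \<infinity>" using fin by (simp add: ennreal_mult_less_top)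
    finally show "(\<integral>\<^sup>+\<omega>. norm (s i \<omega>) \<partial>M) < \<infinity>" .
  qed
  have bound: "ennreal (norm (?I i - ?I j)) \<le> ?d i + ?d j" for i j
  proof -
    have "norm (?I i - ?I j) = norm (Bochner_Integration.simple_bochner_integral M (\<lambda>\<omega>. s i \<omega> - s j \<omega>))"
      by (simp add: simple_bochner_integral_diff sbi)
    also have "\<dots> \<le> Bochner_Integration.simple_bochner_integral M (\<lambda>\<omega>. norm (s i \<omega> - s j \<omega>))"
      using simple_bochner_integrable_compose2[of "(-)", OF _ sbi[of i] sbi[of j]]
      by (intro simple_bochner_integral_norm_bound) simp
    finally have "ennreal (norm (?I i - ?I j))
        \<le> ennreal (Bochner_Integration.simple_bochner_integral M (\<lambda>\<omega>. norm (s i \<omega> - s j \<omega>)))"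
      by (rule ennreal_leI)
    also have "\<dots> = (\<integral>\<^sup>+\<omega>. norm (s i \<omega> - s j \<omega>) \<partial>M)"
      using simple_bochner_integrable_compose2[of "\<lambda>x y. norm (x - y)" M "s i" "s j"] sbi
      by (intro simple_bochner_integral_eq_nn_integral) auto
    also have "\<dots> \<le> (\<integral>\<^sup>+\<omega>. ennreal (norm (f \<omega> - s i \<omega>)) + ennreal (norm (f \<omega> - s j \<omega>)) \<partial>M)"
    proof (intro nn_integral_mono)
      fix \<omega>
      have "norm (s i \<omega> - s j \<omega>) \<le> norm (f \<omega> - s i \<omega>) + norm (f \<omega> - s j \<omega>)"
        by (metis dual_order.refl norm_diff_triangle_le norm_minus_commute)
      then show "ennreal (norm (s i \<omega> - s j \<omega>)) \<le> ennreal (norm (f \<omega> - s i \<omega>)) + ennreal (norm (f \<omega> - s j \<omega>))"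
        by (simp flip: ennreal_plus)
    qed
    also have "\<dots> = ?d i + ?d j" by (rule nn_integral_add) measurable
    finally show ?thesis .
  qed
  have "Cauchy ?I"
  proof (rule CauchyI)
    fix r :: real assume r: "0 < r"
    then have "0 < ennreal (r / 2)" by simp
    then obtain N where N: "\<And>i. N \<le> i \<Longrightarrow> ?d i < ennreal (r / 2)"
      using order_tendstoD(2)[OF d0] by (force simp: eventually_sequentially)
    have "norm (?I i - ?I j) < r" if "N \<le> i" "N \<le> j" for i j
    proof -
      have "ennreal (norm (?I i - ?I j)) < ennreal (r / 2) + ennreal (r / 2)"
        using bound[of i j] add_strict_mono[OF N[OF that(1)] N[OF that(2)]] by (rule order_le_less_trans)
      then show ?thesis using r by (simp flip: ennreal_plus add: ennreal_less_iff)
    qed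
    then show "\<exists>N. \<forall>i\<ge>N. \<forall>j\<ge>N. norm (?I i - ?I j) < r" by blast
  qed
  then obtain x where "?I \<longlonglongrightarrow> x" using Cauchy_convergent convergent_def by blast
  with sbi d0 f show ?thesis
    unfolding integrable_rand_var_def Bochner_has_integral_def by (auto simp: rand_var_def)
qed

text \<open>
Testing a Bochner integral against a fixed vector reduces it to the integral of a real function.
\<close>

lemma Bochner_has_integral_inner:
  fixes f :: "'a \<Rightarrow> 'h::real_inner"
  assumes f: "rand_var M f" and x: "Bochner_has_integral M f x"
  shows "has_bochner_integral M (\<lambda>\<omega>. inner (f \<omega>) u) (inner x u)"
proof -
  obtain s where s: "\<And>i. Bochner_Integration.simple_bochner_integrable M (s i)"
      "(\<lambda>i. \<integral>\<^sup>+\<omega>. norm (f \<omega> - s i \<omega>) \<partial>M) \<longlonglongrightarrow> 0"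
      "(\<lambda>i. Bochner_Integration.simple_bochner_integral M (s i)) \<longlonglongrightarrow> x"
    using x by (auto simp: Bochner_has_integral_def)
  have [measurable]: "(\<lambda>\<omega>. norm (f \<omega> - s i \<omega>)) \<in> borel_measurable M" for i
    using s(1)[of i] by (intro rand_var_norm_measurable rand_var_diff f simple_function_rand_var)
      (auto elim: simple_bochner_integrable.cases)
  show ?thesis
  proof (rule has_bochner_integral.intros[where s = "\<lambda>i \<omega>. inner (s i \<omega>) u"])
    show "(\<lambda>\<omega>. inner (f \<omega>) u) \<in> borel_measurable M"
      by (intro rand_var_inner_measurable f rand_var_const)
    show "Bochner_Integration.simple_bochner_integrable M (\<lambda>\<omega>. inner (s i \<omega>) u)" for i
      using simple_bochner_integrable_compose2[of "\<lambda>x y. inner x u", OF _ s(1)[of i] s(1)[of i]] by simp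
    have "(\<lambda>i. Bochner_Integration.simple_bochner_integral M (\<lambda>\<omega>. inner (s i \<omega>) u)) =
        (\<lambda>i. inner (Bochner_Integration.simple_bochner_integral M (s i)) u)"
      using simple_bochner_integral_linear[OF bounded_linear.linear[OF bounded_linear_inner_left] s(1)]
      by (intro ext)
    then show "(\<lambda>i. Bochner_Integration.simple_bochner_integral M (\<lambda>\<omega>. inner (s i \<omega>) u)) \<longlonglongrightarrow> inner x u"
      using s(3) by (auto intro: tendsto_intros)
    show "(\<lambda>i. \<integral>\<^sup>+\<omega>. norm (inner (f \<omega>) u - inner (s i \<omega>) u) \<partial>M) \<longlonglongrightarrow> 0"
    proof (rule tendsto_sandwich[OF _ _ tendsto_const])
      show "(\<lambda>i. ennreal (norm u) * (\<integral>\<^sup>+\<omega>. norm (f \<omega> - s i \<omega>) \<partial>M)) \<longlonglongrightarrow> 0"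
        using ennreal_tendsto_cmult[OF _ s(2), of "ennreal (norm u)"] by simp
      have "(\<integral>\<^sup>+\<omega>. norm (inner (f \<omega>) u - inner (s i \<omega>) u) \<partial>M)
        \<le> (\<integral>\<^sup>+\<omega>. ennreal (norm u) * norm (f \<omega> - s i \<omega>) \<partial>M)" for i
      proof (intro nn_integral_mono)
        fix \<omega>
        have "norm (inner (f \<omega>) u - inner (s i \<omega>) u) \<le> norm u * norm (f \<omega> - s i \<omega>)"
          using Cauchy_Schwarz_ineq2[of "f \<omega> - s i \<omega>" u] by (simp add: inner_diff_left mult.commute)
        then show "ennreal (norm (inner (f \<omega>) u - inner (s i \<omega>) u)) \<le> ennreal (norm u) * ennreal (norm (f \<omega> - s i \<omega>))"
          by (subst ennreal_mult[symmetric]) (auto intro: ennreal_leI)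
      qed
      then show "\<forall>\<^sub>F i in sequentially. (\<integral>\<^sup>+\<omega>. norm (inner (f \<omega>) u - inner (s i \<omega>) u) \<partial>M)
        \<le> ennreal (norm u) * (\<integral>\<^sup>+\<omega>. norm (f \<omega> - s i \<omega>) \<partial>M)"
        by (subst nn_integral_cmult[symmetric]) (auto intro!: always_eventually)
    qed simp
  qed
qed

lemma square_integrable_dominated:
  assumes h: "rand_var M h" and f: "square_integrable M f" and g: "square_integrable M g"
    and le: "\<And>\<omega>. \<omega> \<in> space M \<Longrightarrow> norm (h \<omega>) \<le> norm (f \<omega>) + norm (g \<omega>)"
  shows "square_integrable M h"
proof -
  have [measurable]: "(\<lambda>\<omega>. norm (h \<omega>)) \<in> borel_measurable M"
    by (intro rand_var_norm_measurable h)
  show ?thesis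
    unfolding square_integrable_def
  proof (rule Bochner_Integration.integrable_bound)
    show "integrable M (\<lambda>\<omega>. 2 * (norm (f \<omega>))\<^sup>2 + 2 * (norm (g \<omega>))\<^sup>2)"
      using f g by (auto simp: square_integrable_def)
    show "AE \<omega> in M. norm ((norm (h \<omega>))\<^sup>2) \<le> norm (2 * (norm (f \<omega>))\<^sup>2 + 2 * (norm (g \<omega>))\<^sup>2)"
    proof (rule AE_I2)
      fix \<omega> assume "\<omega> \<in> space M"
      then have "(norm (h \<omega>))\<^sup>2 \<le> (norm (f \<omega>) + norm (g \<omega>))\<^sup>2"
        using le by (intro power_mono) auto
      also have "\<dots> \<le> 2 * (norm (f \<omega>))\<^sup>2 + 2 * (norm (g \<omega>))\<^sup>2"
        using sum_squares_bound[of "norm (f \<omega>)" "norm (g \<omega>)"] by (simp add: power2_sum)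
      finally show "norm ((norm (h \<omega>))\<^sup>2) \<le> norm (2 * (norm (f \<omega>))\<^sup>2 + 2 * (norm (g \<omega>))\<^sup>2)" by simp
    qed
  qed measurable
qed

lemma square_integrable_inner_integrable:
  fixes f g :: "'a \<Rightarrow> 'h::real_inner"
  assumes "rand_var M f" "rand_var M g" "square_integrable M f" "square_integrable M g"
  shows "integrable M (\<lambda>\<omega>. inner (f \<omega>) (g \<omega>))"
proof (rule Bochner_Integration.integrable_bound)
  show "integrable M (\<lambda>\<omega>. (norm (f \<omega>))\<^sup>2 + (norm (g \<omega>))\<^sup>2)"
    using assms by (auto simp: square_integrable_def)
  show "AE \<omega> in M. norm (inner (f \<omega>) (g \<omega>)) \<le> norm ((norm (f \<omega>))\<^sup>2 + (norm (g \<omega>))\<^sup>2)"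
  proof (rule AE_I2)
    fix \<omega>
    have "\<bar>inner (f \<omega>) (g \<omega>)\<bar> \<le> norm (f \<omega>) * norm (g \<omega>)" by (rule Cauchy_Schwarz_ineq2)
    also have "\<dots> \<le> 2 * norm (f \<omega>) * norm (g \<omega>)" by simp
    also have "\<dots> \<le> (norm (f \<omega>))\<^sup>2 + (norm (g \<omega>))\<^sup>2" by (rule sum_squares_bound)
    finally show "norm (inner (f \<omega>) (g \<omega>)) \<le> norm ((norm (f \<omega>))\<^sup>2 + (norm (g \<omega>))\<^sup>2)" by simp
  qed
qed (intro rand_var_inner_measurable assms)

text \<open>
The defining property of the conditional expectation, tested against a fixed vector, says that
\<open>f - g\<close> is orthogonal to every \<open>F\<close>-measurable simple function. Simple functions approximate \<open>h\<close> with
errors dominated by \<open>h\<close>, so orthogonality to \<open>h\<close> follows by dominated convergence.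
\<close>

lemma is_cond_exp_orthogonal:
  fixes f g h :: "'a \<Rightarrow> 'h::real_inner"
  assumes ce: "is_cond_exp M F f g" and h: "rand_var F h"
    and sq: "square_integrable M f" "square_integrable M g" "square_integrable M h"
  shows "(\<integral>\<omega>. inner (f \<omega> - g \<omega>) (h \<omega>) \<partial>M) = 0"
proof -
  have sub: "subalgebra M F" and f: "rand_var M f" and g: "rand_var M g"
    using ce by (auto simp: is_cond_exp_def integrable_rand_var_def)
  have hM: "rand_var M h" using rand_var_from_subalgebra[OF sub h] .
  have fg: "rand_var M (\<lambda>\<omega>. f \<omega> - g \<omega>)" by (intro rand_var_diff f g)
  have sqfg: "square_integrable M (\<lambda>\<omega>. f \<omega> - g \<omega>)"
    by (rule square_integrable_dominated[OF fg sq(1,2)]) (rule norm_triangle_ineq4)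
  have ind: "has_bochner_integral M (\<lambda>\<omega>. indicator E \<omega> * inner (f \<omega> - g \<omega>) u) 0" if E: "E \<in> sets F" for E u
  proof -
    obtain x where x: "Bochner_has_integral M (\<lambda>\<omega>. indicator E \<omega> *\<^sub>R f \<omega>) x"
        "Bochner_has_integral M (\<lambda>\<omega>. indicator E \<omega> *\<^sub>R g \<omega>) x"
      using ce E by (auto simp: is_cond_exp_def)
    have EM: "E \<in> sets M" using E sub by (auto simp: subalgebra_def)
    have "has_bochner_integral M (\<lambda>\<omega>. inner (indicator E \<omega> *\<^sub>R f \<omega>) u - inner (indicator E \<omega> *\<^sub>R g \<omega>) u)
        (inner x u - inner x u)"
      by (intro has_bochner_integral_diff Bochner_has_integral_inner rand_var_indicator_scaleR EM f g x)
    then show ?thesis by (simp add: inner_diff_left algebra_simps)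
  qed
  obtain s where s: "\<And>i. simple_function F (s i)" "\<And>\<omega>. \<omega> \<in> space F \<Longrightarrow> (\<lambda>i. s i \<omega>) \<longlonglongrightarrow> h \<omega>"
      "\<And>i \<omega>. norm (h \<omega> - s i \<omega>) \<le> norm (h \<omega>)"
    using rand_var_simple_approximation[OF h] by metis
  have sM: "rand_var M (s i)" for i
    using rand_var_from_subalgebra[OF sub simple_function_rand_var[OF s(1)]] .
  have simple: "(\<integral>\<omega>. inner (f \<omega> - g \<omega>) (s i \<omega>) \<partial>M) = 0" for i
  proof -
    have "has_bochner_integral M
        (\<lambda>\<omega>. \<Sum>y\<in>s i ` space F. indicator (s i -` {y} \<inter> space F) \<omega> * inner (f \<omega> - g \<omega>) y) (\<Sum>y\<in>s i ` space F. 0)"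
      using s(1)[of i] by (intro has_bochner_integral_sum ind) (auto simp: simple_function_def)
    moreover have "(\<Sum>y\<in>s i ` space F. indicator (s i -` {y} \<inter> space F) \<omega> * inner (f \<omega> - g \<omega>) y)
        = inner (f \<omega> - g \<omega>) (s i \<omega>)" if "\<omega> \<in> space M" for \<omega>
    proof -
      have \<omega>: "\<omega> \<in> space F" using that sub by (simp add: subalgebra_def)
      have "(\<Sum>y\<in>s i ` space F. indicator (s i -` {y} \<inter> space F) \<omega> * inner (f \<omega> - g \<omega>) y)
        = (\<Sum>y\<in>{s i \<omega>}. indicator (s i -` {y} \<inter> space F) \<omega> * inner (f \<omega> - g \<omega>) y)"
        using s(1)[of i] \<omega> by (intro sum.mono_neutral_right) (auto simp: simple_function_def indicator_def)
      then show ?thesis using \<omega> by simp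
    qed
    ultimately have "has_bochner_integral M (\<lambda>\<omega>. inner (f \<omega> - g \<omega>) (s i \<omega>)) 0"
      by (subst has_bochner_integral_cong[OF refl _ refl]) auto
    then show ?thesis by (rule has_bochner_integral_integral_eq)
  qed
  have "(\<lambda>i. \<integral>\<omega>. inner (f \<omega> - g \<omega>) (s i \<omega>) \<partial>M) \<longlonglongrightarrow> (\<integral>\<omega>. inner (f \<omega> - g \<omega>) (h \<omega>) \<partial>M)"
  proof (rule integral_dominated_convergence[where w = "\<lambda>\<omega>. (norm (f \<omega> - g \<omega>))\<^sup>2 + (norm (h \<omega>))\<^sup>2"])
    show "integrable M (\<lambda>\<omega>. (norm (f \<omega> - g \<omega>))\<^sup>2 + (norm (h \<omega>))\<^sup>2)"
      using sqfg sq(3) by (auto simp: square_integrable_def)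
    show "AE \<omega> in M. (\<lambda>i. inner (f \<omega> - g \<omega>) (s i \<omega>)) \<longlonglongrightarrow> inner (f \<omega> - g \<omega>) (h \<omega>)"
      using s(2) sub by (intro AE_I2 tendsto_intros) (auto simp: subalgebra_def)
    show "AE \<omega> in M. norm (inner (f \<omega> - g \<omega>) (s i \<omega>)) \<le> (norm (f \<omega> - g \<omega>))\<^sup>2 + (norm (h \<omega>))\<^sup>2" for i
    proof (rule AE_I2)
      fix \<omega>
      have "norm (s i \<omega>) \<le> 2 * norm (h \<omega>)"
        using s(3)[of \<omega> i] norm_triangle_ineq3[of "s i \<omega>" "h \<omega>"] by (simp add: norm_minus_commute)
      then have "norm (f \<omega> - g \<omega>) * norm (s i \<omega>) \<le> norm (f \<omega> - g \<omega>) * (2 * norm (h \<omega>))"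
        by (intro mult_left_mono) auto
      then show "norm (inner (f \<omega> - g \<omega>) (s i \<omega>)) \<le> (norm (f \<omega> - g \<omega>))\<^sup>2 + (norm (h \<omega>))\<^sup>2"
        using Cauchy_Schwarz_ineq2[of "f \<omega> - g \<omega>" "s i \<omega>"] sum_squares_bound[of "norm (f \<omega> - g \<omega>)" "norm (h \<omega>)"]
        by simp
    qed
  qed (intro rand_var_inner_measurable fg hM sM)+
  then show ?thesis using LIMSEQ_unique[OF _ tendsto_const] by (simp add: simple)
qed

section \<open>Almost sure convergence of nonnegative supermartingales\<close>

text \<open>
A trader buys one share when the price \<open>u\<close> is at most \<open>a\<close> and sells it when the price is next at least \<open>b\<close>;
\<open>holding a b u n\<close> says that a share is held from time \<open>n\<close> to time \<open>n + 1\<close>, a decision which depends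
only on the prices up to time \<open>n\<close>. The functions \<open>gain\<close> and \<open>upcrossings\<close> record the accumulated
profit and the number of completed trades.
\<close>

fun holding :: "real \<Rightarrow> real \<Rightarrow> (nat \<Rightarrow> real) \<Rightarrow> nat \<Rightarrow> bool" where
  "holding a b u 0 \<longleftrightarrow> u 0 \<le> a"
| "holding a b u (Suc n) \<longleftrightarrow> (if holding a b u n then u (Suc n) < b else u (Suc n) \<le> a)"

fun gain :: "real \<Rightarrow> real \<Rightarrow> (nat \<Rightarrow> real) \<Rightarrow> nat \<Rightarrow> real" where
  "gain a b u 0 = 0"
| "gain a b u (Suc n) = gain a b u n + (if holding a b u n then u (Suc n) - u n else 0)"

fun upcrossings :: "real \<Rightarrow> real \<Rightarrow> (nat \<Rightarrow> real) \<Rightarrow> nat \<Rightarrow> nat" where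
  "upcrossings a b u 0 = 0"
| "upcrossings a b u (Suc n) =
     upcrossings a b u n + (if holding a b u n \<and> b \<le> u (Suc n) then 1 else 0)"

text \<open>
Each completed trade earns at least \<open>b - a\<close>, and an open position has changed its value by at least
\<open>u n - a\<close> since the purchase.
\<close>

lemma upcrossings_le_gain:
  assumes "a < b"
  shows "(b - a) * upcrossings a b u n + (if holding a b u n then u n - a else 0) \<le> gain a b u n"
proof (induction n)
  case (Suc n)
  then show ?case using assms by (auto simp: algebra_simps split: if_splits)
qed simp

text \<open>
After the last completed trade, either a share is held at some time and never sold again, so that the
price stays below \<open>b\<close>, or none is ever bought again, so that it stays above \<open>a\<close>.
\<close>

lemma bounded_upcrossings_imp_separated:
  assumes "\<And>n. upcrossings a b u n \<le> C"
  shows "(\<forall>\<^sub>F n in sequentially. u n < b) \<or> (\<forall>\<^sub>F n in sequentially. a < u n)"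
proof -
  have "incseq (upcrossings a b u)" by (rule incseq_SucI) simp
  moreover have "finite (range (upcrossings a b u))"
    using assms by (rule_tac finite_subset[of _ "{..C}"]) auto
  moreover from calculation(2) have "Max (range (upcrossings a b u)) \<in> range (upcrossings a b u)"
    by (intro Max_in) auto
  then obtain N where "upcrossings a b u N = Max (range (upcrossings a b u))" by force
  ultimately have N: "upcrossings a b u n = upcrossings a b u N" if "N \<le> n" for n
    using that by (metis Max_ge incseqD order_antisym rangeI)
  have nocross: "\<not> (holding a b u n \<and> b \<le> u (Suc n))" if "N \<le> n" for n
    using N[of n] N[of "Suc n"] that by (auto split: if_splits)
  show ?thesis
  proof (cases "\<exists>m\<ge>N. holding a b u m")
    case True
    then obtain m where m: "N \<le> m" "holding a b u m" by blast
    have hold: "holding a b u n" if "m \<le> n" for n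
      using that
    proof (induction n rule: dec_induct)
      case (step n)
      then show ?case using nocross[of n] m by auto
    qed (use m in simp)
    have "u n < b" if n: "Suc m \<le> n" for n
    proof -
      obtain k where k: "n = Suc k" "m \<le> k" using n by (cases n) auto
      show ?thesis using nocross[of k] hold[of k] k m by auto
    qed
    then show ?thesis by (auto simp: eventually_sequentially)
  next
    case False
    have "a < u n" if n: "Suc N \<le> n" for n
    proof -
      obtain k where k: "n = Suc k" "N \<le> k" using n by (cases n) auto
      show ?thesis using False k by (metis holding.simps(2) le_SucI not_le)
    qed
    then show ?thesis by (auto simp: eventually_sequentially)
  qed
qed

text \<open>
The limit is the lower limit \<open>c\<close>. Given \<open>x > c\<close>, choose rational \<open>a\<close> and \<open>b\<close> with \<open>c < a < b < x\<close>. The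
sequence is not eventually above \<open>a\<close>, hence it is eventually below \<open>b\<close>.
\<close>

lemma separated_imp_convergent:
  fixes u :: "nat \<Rightarrow> real"
  assumes u: "\<And>n. 0 \<le> u n" and fin: "liminf (\<lambda>n. ennreal (u n)) < \<infinity>"
    and sep: "\<And>a b :: rat. 0 \<le> a \<Longrightarrow> a < b \<Longrightarrow>
      (\<forall>\<^sub>F n in sequentially. u n < of_rat b) \<or> (\<forall>\<^sub>F n in sequentially. of_rat a < u n)"
  shows "convergent u"
proof -
  obtain c where c: "liminf (\<lambda>n. ennreal (u n)) = ennreal c" "0 \<le> c"
    using fin by (cases "liminf (\<lambda>n. ennreal (u n))") auto
  have "u \<longlonglongrightarrow> c"
  proof (rule order_tendstoI)
    fix x assume x: "x < c"
    show "\<forall>\<^sub>F n in sequentially. x < u n"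
    proof (cases "x < 0")
      case True
      then show ?thesis using u by (auto intro!: always_eventually intro: less_le_trans)
    next
      case False
      then have "ennreal x < liminf (\<lambda>n. ennreal (u n))"
        using x c by (simp add: ennreal_less_iff)
      then have "\<forall>\<^sub>F n in sequentially. ennreal x < ennreal (u n)" by (rule less_LiminfD)
      then show ?thesis using False by (simp add: ennreal_less_iff)
    qed
  next
    fix x assume x: "c < x"
    obtain b :: rat where b: "c < of_rat b" "of_rat b < x" using of_rat_dense[OF x] by blast
    obtain a :: rat where a: "c < of_rat a" "of_rat a < real_of_rat b" using of_rat_dense[OF b(1)] by blast
    have ab: "0 \<le> a" "a < b" using a c(2) by (auto simp: of_rat_less) (metis less_eq_real_def order_le_less_trans zero_le_of_rat_iff)
    have "\<not> (\<forall>\<^sub>F n in sequentially. of_rat a < u n)"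
    proof
      assume "\<forall>\<^sub>F n in sequentially. of_rat a < u n"
      then have "ennreal (of_rat a) \<le> liminf (\<lambda>n. ennreal (u n))"
        by (intro Liminf_bounded) (auto elim!: eventually_mono intro: ennreal_leI)
      then show False using c a(1) by (simp add: ennreal_le_iff)
    qed
    with sep[OF ab] have "\<forall>\<^sub>F n in sequentially. u n < of_rat b" by blast
    then show "\<forall>\<^sub>F n in sequentially. u n < x" by eventually_elim (use b in simp)
  qed
  then show ?thesis by (auto simp: convergent_def)
qed

text \<open>
The supermartingale inequality is stated in integrated form, over all events of the past, which is
equivalent to the one for conditional expectations and easier to apply and to verify.
\<close>

locale nonneg_supermartingale = prob_space M for M :: "'a measure" +
  fixes F :: "nat \<Rightarrow> 'a measure" and U :: "nat \<Rightarrow> 'a \<Rightarrow> real"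
  assumes subalg: "\<And>n. subalgebra M (F n)"
    and filtration: "\<And>n. sets (F n) \<subseteq> sets (F (Suc n))"
    and adapted: "\<And>n. U n \<in> borel_measurable (F n)"
    and nonneg: "\<And>n \<omega>. \<omega> \<in> space M \<Longrightarrow> 0 \<le> U n \<omega>"
    and integrable_U: "\<And>n. integrable M (U n)"
    and decreasing: "\<And>n E. E \<in> sets (F n) \<Longrightarrow>
      (\<integral>\<omega>. indicator E \<omega> * U (Suc n) \<omega> \<partial>M) \<le> (\<integral>\<omega>. indicator E \<omega> * U n \<omega> \<partial>M)"
begin

lemma measurable_U [measurable]: "U n \<in> borel_measurable M"
  using integrable_U by auto

lemma holding_measurable: "{\<omega> \<in> space M. holding a b (\<lambda>k. U k \<omega>) n} \<in> sets (F n)"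
proof (induction n)
  case 0
  have [measurable]: "U 0 \<in> borel_measurable (F 0)" by (rule adapted)
  have "{\<omega> \<in> space (F 0). U 0 \<omega> \<le> a} \<in> sets (F 0)" by measurable
  moreover have "space (F 0) = space M" using subalg[of 0] by (simp add: subalgebra_def)
  ultimately show ?case by simp
next
  case (Suc n)
  have sp: "space (F (Suc n)) = space M" using subalg by (simp add: subalgebra_def)
  have [measurable]: "U (Suc n) \<in> borel_measurable (F (Suc n))" by (rule adapted)
  let ?H = "{\<omega> \<in> space M. holding a b (\<lambda>k. U k \<omega>) n}"
  have [measurable]: "?H \<in> sets (F (Suc n))" using Suc filtration by blast
  have "{\<omega> \<in> space (F (Suc n)). if \<omega> \<in> ?H then U (Suc n) \<omega> < b else U (Suc n) \<omega> \<le> a} \<in> sets (F (Suc n))"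
    by measurable
  also have "{\<omega> \<in> space (F (Suc n)). if \<omega> \<in> ?H then U (Suc n) \<omega> < b else U (Suc n) \<omega> \<le> a}
     = {\<omega> \<in> space M. holding a b (\<lambda>k. U k \<omega>) (Suc n)}"
    unfolding sp by (intro Collect_cong) auto
  finally show ?case .
qed

lemma gain_integrable: "integrable M (\<lambda>\<omega>. gain a b (\<lambda>k. U k \<omega>) n)"
  and expectation_gain_le: "(\<integral>\<omega>. gain a b (\<lambda>k. U k \<omega>) n \<partial>M) \<le> 0"
proof -
  have "integrable M (\<lambda>\<omega>. gain a b (\<lambda>k. U k \<omega>) n) \<and> (\<integral>\<omega>. gain a b (\<lambda>k. U k \<omega>) n \<partial>M) \<le> 0"
  proof (induction n)
    case (Suc n)
    let ?H = "{\<omega> \<in> space M. holding a b (\<lambda>k. U k \<omega>) n}"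
    have H: "?H \<in> sets M" using holding_measurable[where a = a and b = b and n = n] subalg[of n] unfolding subalgebra_def by blast
    have int: "integrable M (\<lambda>\<omega>. indicator ?H \<omega> * U k \<omega>)" for k
      using integrable_mult_indicator[OF H integrable_U[of k]] by simp
    have eq: "gain a b (\<lambda>k. U k \<omega>) (Suc n) = gain a b (\<lambda>k. U k \<omega>) n +
        (indicator ?H \<omega> * U (Suc n) \<omega> - indicator ?H \<omega> * U n \<omega>)" if "\<omega> \<in> space M" for \<omega>
      using that by (simp add: indicator_def)
    have "integrable M (\<lambda>\<omega>. gain a b (\<lambda>k. U k \<omega>) (Suc n))"
      by (subst Bochner_Integration.integrable_cong[OF refl eq]) (use Suc int in auto)
    moreover have "(\<integral>\<omega>. gain a b (\<lambda>k. U k \<omega>) (Suc n) \<partial>M) = (\<integral>\<omega>. gain a b (\<lambda>k. U k \<omega>) n \<partial>M) +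
        ((\<integral>\<omega>. indicator ?H \<omega> * U (Suc n) \<omega> \<partial>M) - (\<integral>\<omega>. indicator ?H \<omega> * U n \<omega> \<partial>M))"
      by (subst Bochner_Integration.integral_cong[OF refl eq]) (use Suc int in auto)
    ultimately show ?case
      using Suc decreasing[OF holding_measurable[where a = a and b = b and n = n]] by simp
  qed simp
  then show "integrable M (\<lambda>\<omega>. gain a b (\<lambda>k. U k \<omega>) n)" "(\<integral>\<omega>. gain a b (\<lambda>k. U k \<omega>) n \<partial>M) \<le> 0"
    by auto
qed

lemma upcrossings_measurable [measurable]:
  "(\<lambda>\<omega>. upcrossings a b (\<lambda>k. U k \<omega>) n) \<in> measurable M (count_space UNIV)"
proof (induction n)
  case (Suc n)
  note Suc[measurable]
  have [measurable]: "Measurable.pred M (\<lambda>\<omega>. holding a b (\<lambda>k. U k \<omega>) n)"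
    using holding_measurable[where a = a and b = b and n = n] subalg[of n] unfolding pred_def subalgebra_def by blast
  show ?case by simp
qed simp

text \<open>
The strategy does not look into the future, so its expected gain is not positive; as prices are
nonnegative, an open position accounts for a loss of at most \<open>a\<close>.
\<close>

lemma nn_integral_upcrossings_le:
  assumes "0 \<le> a" "a < b"
  shows "(\<integral>\<^sup>+\<omega>. ennreal (upcrossings a b (\<lambda>k. U k \<omega>) n) \<partial>M) \<le> ennreal (a / (b - a))"
proof -
  have "(\<integral>\<^sup>+\<omega>. ennreal (upcrossings a b (\<lambda>k. U k \<omega>) n) \<partial>M)
      \<le> (\<integral>\<^sup>+\<omega>. ennreal ((gain a b (\<lambda>k. U k \<omega>) n + a) / (b - a)) \<partial>M)"
  proof (intro nn_integral_mono ennreal_leI)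
    fix \<omega> assume "\<omega> \<in> space M"
    then have "- a \<le> (if holding a b (\<lambda>k. U k \<omega>) n then U n \<omega> - a else 0)"
      using nonneg assms by auto
    with upcrossings_le_gain[OF assms(2), of "\<lambda>k. U k \<omega>" n]
    have "(b - a) * upcrossings a b (\<lambda>k. U k \<omega>) n \<le> gain a b (\<lambda>k. U k \<omega>) n + a" by linarith
    then show "real (upcrossings a b (\<lambda>k. U k \<omega>) n) \<le> (gain a b (\<lambda>k. U k \<omega>) n + a) / (b - a)"
      using assms by (simp add: field_simps)
  qed
  also have "\<dots> = ennreal (\<integral>\<omega>. (gain a b (\<lambda>k. U k \<omega>) n + a) / (b - a) \<partial>M)"
  proof (rule nn_integral_eq_integral)
    show "integrable M (\<lambda>\<omega>. (gain a b (\<lambda>k. U k \<omega>) n + a) / (b - a))"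
      using gain_integrable by auto
    show "AE \<omega> in M. 0 \<le> (gain a b (\<lambda>k. U k \<omega>) n + a) / (b - a)"
    proof (rule AE_I2)
      fix \<omega> assume "\<omega> \<in> space M"
      then have "- a \<le> (if holding a b (\<lambda>k. U k \<omega>) n then U n \<omega> - a else 0)"
        using nonneg assms by auto
      moreover have "0 \<le> (b - a) * upcrossings a b (\<lambda>k. U k \<omega>) n" using assms by simp
      ultimately have "0 \<le> gain a b (\<lambda>k. U k \<omega>) n + a"
        using upcrossings_le_gain[OF assms(2), of "\<lambda>k. U k \<omega>" n] by linarith
      then show "0 \<le> (gain a b (\<lambda>k. U k \<omega>) n + a) / (b - a)" using assms by simp
    qed
  qed
  also have "\<dots> = ennreal (((\<integral>\<omega>. gain a b (\<lambda>k. U k \<omega>) n \<partial>M) + a) / (b - a))"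
    using gain_integrable by (simp add: prob_space)
  also have "\<dots> \<le> ennreal (a / (b - a))"
    using expectation_gain_le assms by (intro ennreal_leI divide_right_mono) auto
  finally show ?thesis .
qed

lemma AE_bounded_upcrossings:
  assumes "0 \<le> a" "a < b"
  shows "AE \<omega> in M. \<exists>C. \<forall>n. upcrossings a b (\<lambda>k. U k \<omega>) n \<le> C"
proof -
  let ?c = "\<lambda>n \<omega>. ennreal (upcrossings a b (\<lambda>k. U k \<omega>) n)"
  have "(\<integral>\<^sup>+\<omega>. (SUP n. ?c n \<omega>) \<partial>M) = (SUP n. \<integral>\<^sup>+\<omega>. ?c n \<omega> \<partial>M)"
    by (rule nn_integral_monotone_convergence_SUP)
       (auto intro!: incseq_SucI ennreal_leI simp: le_fun_def)
  also have "\<dots> \<le> ennreal (a / (b - a))"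
    by (intro SUP_least nn_integral_upcrossings_le assms)
  also have "\<dots> < \<infinity>" by simp
  finally have "(\<integral>\<^sup>+\<omega>. (SUP n. ?c n \<omega>) \<partial>M) \<noteq> \<infinity>" by simp
  then have "AE \<omega> in M. (SUP n. ?c n \<omega>) \<noteq> \<infinity>"
    by (intro nn_integral_PInf_AE) auto
  then show ?thesis
  proof eventually_elim
    fix \<omega> assume "(SUP n. ?c n \<omega>) \<noteq> \<infinity>"
    then obtain r where r: "(SUP n. ?c n \<omega>) = ennreal r" "0 \<le> r"
      by (cases "SUP n. ?c n \<omega>") auto
    have "?c n \<omega> \<le> ennreal r" for n
      unfolding r(1)[symmetric] by (rule SUP_upper) simp
    then have "real (upcrossings a b (\<lambda>k. U k \<omega>) n) \<le> r" for n
      using r(2) by (simp add: ennreal_le_iff)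
    then show "\<exists>C. \<forall>n. upcrossings a b (\<lambda>k. U k \<omega>) n \<le> C"
      by (intro exI[of _ "nat \<lfloor>r\<rfloor>"]) (simp add: le_nat_floor)
  qed
qed

lemma expectation_le_initial: "(\<integral>\<omega>. U n \<omega> \<partial>M) \<le> (\<integral>\<omega>. U 0 \<omega> \<partial>M)"
proof (induction n)
  case (Suc n)
  have "space M \<in> sets (F n)" using subalg[of n] by (metis sets.top subalgebra_def)
  from decreasing[OF this] have "(\<integral>\<omega>. U (Suc n) \<omega> \<partial>M) \<le> (\<integral>\<omega>. U n \<omega> \<partial>M)"
    by (simp cong: Bochner_Integration.integral_cong)
  with Suc show ?case by simp
qed simp

text \<open>
By Fatou's lemma the lower limit is integrable, in particular almost surely finite, and for almost
every \<open>\<omega>\<close> the upcrossings are bounded simultaneously for all rational \<open>a < b\<close>.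
\<close>

theorem convergence:
  obtains \<zeta> where "integrable M \<zeta>" "AE \<omega> in M. (\<lambda>n. U n \<omega>) \<longlonglongrightarrow> \<zeta> \<omega>"
proof -
  have 1: "(\<integral>\<^sup>+\<omega>. liminf (\<lambda>n. ennreal (U n \<omega>)) \<partial>M) \<le> liminf (\<lambda>n. \<integral>\<^sup>+\<omega>. ennreal (U n \<omega>) \<partial>M)"
    by (rule nn_integral_liminf) simp
  have 2: "liminf (\<lambda>n. \<integral>\<^sup>+\<omega>. ennreal (U n \<omega>) \<partial>M) \<le> ennreal (\<integral>\<omega>. U 0 \<omega> \<partial>M)"
  proof (rule Liminf_le[OF sequentially_bot])
    have "(\<integral>\<^sup>+\<omega>. ennreal (U n \<omega>) \<partial>M) = ennreal (\<integral>\<omega>. U n \<omega> \<partial>M)" for n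
      using nonneg by (intro nn_integral_eq_integral integrable_U AE_I2)
    then show "\<forall>\<^sub>F n in sequentially. (\<integral>\<^sup>+\<omega>. ennreal (U n \<omega>) \<partial>M) \<le> ennreal (\<integral>\<omega>. U 0 \<omega> \<partial>M)"
      using expectation_le_initial by (auto intro!: always_eventually ennreal_leI)
  qed
  have fatou: "(\<integral>\<^sup>+\<omega>. liminf (\<lambda>n. ennreal (U n \<omega>)) \<partial>M) < \<infinity>"
    using order_le_less_trans[OF order_trans[OF 1 2] ennreal_less_top] by simp
  have "(\<lambda>\<omega>. liminf (\<lambda>n. ennreal (U n \<omega>))) \<in> borel_measurable M"
    by measurable
  then have fin: "AE \<omega> in M. liminf (\<lambda>n. ennreal (U n \<omega>)) \<noteq> \<infinity>"
    using fatou by (rule_tac nn_integral_PInf_AE) (simp_all add: less_top)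
  have rat_bdd: "AE \<omega> in M. \<forall>a b :: rat. 0 \<le> a \<longrightarrow> a < b \<longrightarrow>
      (\<exists>C. \<forall>n. upcrossings (of_rat a) (of_rat b) (\<lambda>k. U k \<omega>) n \<le> C)"
    unfolding AE_all_countable using AE_bounded_upcrossings
    by (intro allI AE_impI) (auto simp: of_rat_less)
  have conv: "AE \<omega> in M. convergent (\<lambda>n. U n \<omega>)"
    using fin AE_space rat_bdd
  proof eventually_elim
    case (elim \<omega>)
    show ?case
    proof (rule separated_imp_convergent)
      show "(\<forall>\<^sub>F n in sequentially. U n \<omega> < of_rat b) \<or> (\<forall>\<^sub>F n in sequentially. of_rat a < U n \<omega>)"
        if ab: "0 \<le> a" "a < b" for a b :: rat
      proof -
        from elim(3)[rule_format, OF ab]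
        obtain C where C: "\<forall>n. upcrossings (of_rat a) (of_rat b) (\<lambda>k. U k \<omega>) n \<le> C" ..
        show ?thesis by (rule bounded_upcrossings_imp_separated[OF C[rule_format]])
      qed
      show "0 \<le> U n \<omega>" for n using elim(2) by (rule nonneg)
      show "liminf (\<lambda>n. ennreal (U n \<omega>)) < \<infinity>" using elim(1) by (simp add: less_top)
    qed
  qed
  define \<zeta> where "\<zeta> \<omega> = lim (\<lambda>n. U n \<omega>)" for \<omega>
  have [measurable]: "\<zeta> \<in> borel_measurable M"
    unfolding \<zeta>_def by measurable
  have lim: "AE \<omega> in M. (\<lambda>n. U n \<omega>) \<longlonglongrightarrow> \<zeta> \<omega>"
    using conv by eventually_elim (simp add: \<zeta>_def convergent_LIMSEQ_iff)
  have "integrable M \<zeta>"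
  proof (rule integrableI_bounded)
    have "AE \<omega> in M. ennreal (norm (\<zeta> \<omega>)) = liminf (\<lambda>n. ennreal (U n \<omega>))"
      using lim AE_space
    proof eventually_elim
      case (elim \<omega>)
      have "0 \<le> \<zeta> \<omega>" using elim nonneg by (intro LIMSEQ_le_const[OF elim(1)]) auto
      moreover have "liminf (\<lambda>n. ennreal (U n \<omega>)) = ennreal (\<zeta> \<omega>)"
        using elim(1) by (intro lim_imp_Liminf tendsto_ennrealI trivial_limit_sequentially)
      ultimately show ?case by simp
    qed
    then have "(\<integral>\<^sup>+\<omega>. ennreal (norm (\<zeta> \<omega>)) \<partial>M) = (\<integral>\<^sup>+\<omega>. liminf (\<lambda>n. ennreal (U n \<omega>)) \<partial>M)"
      by (rule nn_integral_cong_AE)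
    then show "(\<integral>\<^sup>+\<omega>. ennreal (norm (\<zeta> \<omega>)) \<partial>M) < \<infinity>" using fatou by simp
  qed simp
  from this lim show thesis by (rule that)
qed

end

text \<open>
Adding the tail sums of \<open>c\<close> turns \<open>V\<close> into a nonnegative supermartingale, whose limit is that of \<open>V\<close>
since the tails vanish. Its expectation drops by at least the expectation of \<open>\<xi> n\<close> in each step,
so these expectations are summable.
\<close>

lemma (in prob_space) robbins_siegmund:
  fixes F :: "nat \<Rightarrow> 'a measure" and V \<xi> :: "nat \<Rightarrow> 'a \<Rightarrow> real" and c :: "nat \<Rightarrow> real"
  assumes subalg: "\<And>n. subalgebra M (F n)"
    and filtration: "\<And>n. sets (F n) \<subseteq> sets (F (Suc n))"
    and V: "\<And>n. V n \<in> borel_measurable (F n)" "\<And>n. integrable M (V n)"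
      "\<And>n \<omega>. \<omega> \<in> space M \<Longrightarrow> 0 \<le> V n \<omega>"
    and \<xi>: "\<And>n. integrable M (\<xi> n)" "\<And>n \<omega>. \<omega> \<in> space M \<Longrightarrow> 0 \<le> \<xi> n \<omega>"
    and c: "\<And>n. 0 \<le> c n" "summable c"
    and step: "\<And>n E. E \<in> sets (F n) \<Longrightarrow>
      (\<integral>\<omega>. indicator E \<omega> * V (Suc n) \<omega> \<partial>M) \<le> (\<integral>\<omega>. indicator E \<omega> * (V n \<omega> - \<xi> n \<omega> + c n) \<partial>M)"
  obtains \<zeta> where "integrable M \<zeta>" "AE \<omega> in M. (\<lambda>n. V n \<omega>) \<longlonglongrightarrow> \<zeta> \<omega>"
    and "AE \<omega> in M. summable (\<lambda>n. \<xi> n \<omega>)"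
proof -
  define r where "r n = suminf c - (\<Sum>k<n. c k)" for n
  have r_Suc: "r n = c n + r (Suc n)" for n by (simp add: r_def)
  have r_nonneg: "0 \<le> r n" for n
    using sum_le_suminf[OF c(2), of "{..<n}"] c(1) by (simp add: r_def)
  have r_lim: "r \<longlonglongrightarrow> 0"
    unfolding r_def using tendsto_diff[OF tendsto_const summable_LIMSEQ[OF c(2)], of "suminf c"] by simp
  define U where "U = (\<lambda>n \<omega>. V n \<omega> + r n)"
  have [simp]: "integrable M (U n)" for n using V(2) by (simp add: U_def)
  have int: "integrable M (\<lambda>\<omega>. indicator E \<omega> * f \<omega>)" if "E \<in> sets (F n)" "integrable M f" for E n and f :: "'a \<Rightarrow> real"
    using integrable_mult_indicator[of E M f] that subalg[of n] by (auto simp: subalgebra_def)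
  have dec: "(\<integral>\<omega>. indicator E \<omega> * U (Suc n) \<omega> \<partial>M) \<le> (\<integral>\<omega>. indicator E \<omega> * (U n \<omega> - \<xi> n \<omega>) \<partial>M)"
    if E: "E \<in> sets (F n)" for E n
  proof -
    have "(\<integral>\<omega>. indicator E \<omega> * U (Suc n) \<omega> \<partial>M)
        = (\<integral>\<omega>. indicator E \<omega> * V (Suc n) \<omega> + indicator E \<omega> * r (Suc n) \<partial>M)"
      by (simp add: U_def distrib_left)
    also have "\<dots> = (\<integral>\<omega>. indicator E \<omega> * V (Suc n) \<omega> \<partial>M) + (\<integral>\<omega>. indicator E \<omega> * r (Suc n) \<partial>M)"
      using E V(2) by (intro Bochner_Integration.integral_add int) auto
    also have "\<dots> \<le> (\<integral>\<omega>. indicator E \<omega> * (V n \<omega> - \<xi> n \<omega> + c n) \<partial>M) + (\<integral>\<omega>. indicator E \<omega> * r (Suc n) \<partial>M)"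
      using step[OF E] by simp
    also have "\<dots> = (\<integral>\<omega>. indicator E \<omega> * (V n \<omega> - \<xi> n \<omega> + c n) + indicator E \<omega> * r (Suc n) \<partial>M)"
      using E V(2) \<xi>(1) by (intro Bochner_Integration.integral_add[symmetric] int) auto
    also have "\<dots> = (\<integral>\<omega>. indicator E \<omega> * (U n \<omega> - \<xi> n \<omega>) \<partial>M)"
      by (intro Bochner_Integration.integral_cong refl) (simp add: U_def r_Suc[of n] algebra_simps)
    finally show ?thesis .
  qed
  interpret S: nonneg_supermartingale M F U
  proof
    show "U n \<in> borel_measurable (F n)" for n
      using V(1)[of n] by (simp add: U_def)
    show "(\<integral>\<omega>. indicator E \<omega> * U (Suc n) \<omega> \<partial>M) \<le> (\<integral>\<omega>. indicator E \<omega> * U n \<omega> \<partial>M)"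
      if E: "E \<in> sets (F n)" for E n
      by (rule order_trans[OF dec[OF E]], intro integral_mono int[OF E])
         (use \<xi> in \<open>auto intro: mult_left_mono\<close>)
  qed (use subalg filtration V r_nonneg in \<open>auto simp: U_def\<close>)
  obtain \<zeta> where \<zeta>: "integrable M \<zeta>" "AE \<omega> in M. (\<lambda>n. U n \<omega>) \<longlonglongrightarrow> \<zeta> \<omega>"
    by (rule S.convergence)
  have "AE \<omega> in M. (\<lambda>n. V n \<omega>) \<longlonglongrightarrow> \<zeta> \<omega>"
    using \<zeta>(2)
  proof eventually_elim
    case (elim \<omega>)
    show ?case using tendsto_diff[OF elim r_lim] by (simp add: U_def)
  qed
  moreover have "AE \<omega> in M. summable (\<lambda>n. \<xi> n \<omega>)"
  proof -
    have mean: "(\<integral>\<omega>. U (Suc n) \<omega> \<partial>M) \<le> (\<integral>\<omega>. U n \<omega> \<partial>M) - (\<integral>\<omega>. \<xi> n \<omega> \<partial>M)" for n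
    proof -
      have sp: "space M \<in> sets (F n)" using subalg[of n] by (metis sets.top subalgebra_def)
      have "(\<integral>\<omega>. U (Suc n) \<omega> \<partial>M) \<le> (\<integral>\<omega>. U n \<omega> - \<xi> n \<omega> \<partial>M)"
        using dec[OF sp] by (simp cong: Bochner_Integration.integral_cong)
      then show ?thesis using \<xi>(1) by simp
    qed
    have sums: "(\<Sum>k<n. \<integral>\<omega>. \<xi> k \<omega> \<partial>M) \<le> (\<integral>\<omega>. U 0 \<omega> \<partial>M) - (\<integral>\<omega>. U n \<omega> \<partial>M)" for n
    proof (induction n)
      case (Suc n)
      then show ?case using mean[of n] by simp
    qed simp
    have [measurable]: "\<xi> n \<in> borel_measurable M" for n using \<xi>(1) by auto
    have "summable (\<lambda>k. \<integral>\<omega>. \<xi> k \<omega> \<partial>M)"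
    proof (rule summableI_nonneg_bounded)
      show "0 \<le> (\<integral>\<omega>. \<xi> n \<omega> \<partial>M)" for n using \<xi>(2) by (intro Bochner_Integration.integral_nonneg_AE AE_I2)
      show "(\<Sum>k<n. \<integral>\<omega>. \<xi> k \<omega> \<partial>M) \<le> (\<integral>\<omega>. U 0 \<omega> \<partial>M)" for n
      proof -
        have "0 \<le> (\<integral>\<omega>. U n \<omega> \<partial>M)" using S.nonneg by (intro Bochner_Integration.integral_nonneg_AE AE_I2)
        then show ?thesis using sums[of n] by simp
      qed
    qed
    then have "(\<Sum>k. ennreal (\<integral>\<omega>. \<xi> k \<omega> \<partial>M)) < \<infinity>"
      using \<xi>(2) by (subst suminf_ennreal2) (auto intro!: Bochner_Integration.integral_nonneg_AE)
    moreover have "(\<integral>\<^sup>+\<omega>. (\<Sum>k. ennreal (\<xi> k \<omega>)) \<partial>M) = (\<Sum>k. ennreal (\<integral>\<omega>. \<xi> k \<omega> \<partial>M))"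
      using \<xi> by (simp add: nn_integral_suminf nn_integral_eq_integral AE_I2)
    ultimately have "AE \<omega> in M. (\<Sum>k. ennreal (\<xi> k \<omega>)) \<noteq> \<infinity>"
      by (intro nn_integral_PInf_AE) (simp_all add: less_top)
    then show ?thesis
      using AE_space
    proof eventually_elim
      case (elim \<omega>)
      then show ?case using \<xi>(2) by (intro summable_suminf_not_top) auto
    qed
  qed
  ultimately show thesis using that \<zeta>(1) by blast
qed

text \<open>
On the event of \<open>F\<close> where the conditional expectation exceeds \<open>G\<close>, the integrated inequality bounds its
integral by the finite integral of \<open>G\<close>, which is only possible if the event is null.
\<close>

lemma (in finite_measure_subalgebra) nn_cond_exp_leI:
  fixes X G :: "'a \<Rightarrow> real"
  assumes X: "integrable M X" "\<And>\<omega>. \<omega> \<in> space M \<Longrightarrow> 0 \<le> X \<omega>"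
    and G: "integrable M G" "G \<in> borel_measurable F" "\<And>\<omega>. \<omega> \<in> space M \<Longrightarrow> 0 \<le> G \<omega>"
    and le: "\<And>E. E \<in> sets F \<Longrightarrow> (\<integral>\<omega>. indicator E \<omega> * X \<omega> \<partial>M) \<le> (\<integral>\<omega>. indicator E \<omega> * G \<omega> \<partial>M)"
  shows "AE \<omega> in M. nn_cond_exp M F (\<lambda>\<omega>. ennreal (X \<omega>)) \<omega> \<le> ennreal (G \<omega>)"
proof -
  let ?N = "nn_cond_exp M F (\<lambda>\<omega>. ennreal (X \<omega>))"
  \<comment> \<open>the event on which the claim fails; it belongs to \<open>F\<close>, so the hypothesis applies to it\<close>
  define E where "E = {\<omega> \<in> space F. ennreal (G \<omega>) < ?N \<omega>}"
  have [measurable]: "G \<in> borel_measurable F" "G \<in> borel_measurable M" "X \<in> borel_measurable M"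
    using G X by auto
  have EF [measurable]: "E \<in> sets F" unfolding E_def by measurable
  have EM [measurable]: "E \<in> sets M" using EF subalg by (auto simp: subalgebra_def)
  have ind: "indicator E \<omega> * ennreal (f \<omega>) = ennreal (indicator E \<omega> * f \<omega>)" for f \<omega>
    by (auto simp: indicator_def)
  have nn: "(\<integral>\<^sup>+\<omega>. indicator E \<omega> * ennreal (f \<omega>) \<partial>M) = ennreal (\<integral>\<omega>. indicator E \<omega> * f \<omega> \<partial>M)"
    if "integrable M f" "\<And>\<omega>. \<omega> \<in> space M \<Longrightarrow> 0 \<le> f \<omega>" for f
    unfolding ind using that integrable_mult_indicator[OF EM that(1)]
    by (intro nn_integral_eq_integral AE_I2) auto
  have "(\<integral>\<^sup>+\<omega>. indicator E \<omega> * ?N \<omega> \<partial>M) = (\<integral>\<^sup>+\<omega>. indicator E \<omega> * ennreal (X \<omega>) \<partial>M)"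
    by (rule nn_cond_exp_intg) measurable
  also have "\<dots> \<le> (\<integral>\<^sup>+\<omega>. indicator E \<omega> * ennreal (G \<omega>) \<partial>M)"
  proof -
    have "(\<integral>\<^sup>+\<omega>. indicator E \<omega> * ennreal (X \<omega>) \<partial>M) = ennreal (\<integral>\<omega>. indicator E \<omega> * X \<omega> \<partial>M)"
      by (rule nn[OF X])
    also have "\<dots> \<le> ennreal (\<integral>\<omega>. indicator E \<omega> * G \<omega> \<partial>M)"
      by (intro ennreal_leI le EF)
    also have "\<dots> = (\<integral>\<^sup>+\<omega>. indicator E \<omega> * ennreal (G \<omega>) \<partial>M)"
      by (rule nn[OF G(1,3), symmetric])
    finally show ?thesis .
  qed
  finally have 1: "(\<integral>\<^sup>+\<omega>. indicator E \<omega> * ?N \<omega> \<partial>M) \<le> (\<integral>\<^sup>+\<omega>. indicator E \<omega> * ennreal (G \<omega>) \<partial>M)" .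
  have "(\<integral>\<^sup>+\<omega>. indicator E \<omega> * ?N \<omega> - indicator E \<omega> * ennreal (G \<omega>) \<partial>M)
     = (\<integral>\<^sup>+\<omega>. indicator E \<omega> * ?N \<omega> \<partial>M) - (\<integral>\<^sup>+\<omega>. indicator E \<omega> * ennreal (G \<omega>) \<partial>M)"
  proof (rule nn_integral_diff)
    show "(\<integral>\<^sup>+\<omega>. indicator E \<omega> * ennreal (G \<omega>) \<partial>M) \<noteq> \<infinity>"
      using nn[OF G(1,3)] by simp
    show "AE \<omega> in M. indicator E \<omega> * ennreal (G \<omega>) \<le> indicator E \<omega> * ?N \<omega>"
      by (intro AE_I2) (auto simp: E_def indicator_def)
  qed measurable
  also have "\<dots> = 0"
  proof -
    have "(\<integral>\<^sup>+\<omega>. indicator E \<omega> * ?N \<omega> \<partial>M) < \<infinity>"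
      by (rule order_le_less_trans[OF 1]) (simp add: nn[OF G(1,3)])
    then show ?thesis using 1 by (simp add: diff_eq_0_iff_ennreal)
  qed
  finally have "AE \<omega> in M. indicator E \<omega> * ?N \<omega> - indicator E \<omega> * ennreal (G \<omega>) = 0"
    by (subst (asm) nn_integral_0_iff_AE) auto
  then show ?thesis
    using AE_space
  proof eventually_elim
    case (elim \<omega>)
    show ?case
    proof (rule ccontr)
      assume "\<not> ?N \<omega> \<le> ennreal (G \<omega>)"
      then have "\<omega> \<in> E" "ennreal (G \<omega>) < ?N \<omega>"
        using elim(2) subalg by (auto simp: E_def subalgebra_def)
      then show False using elim(1) by (auto simp: diff_eq_0_iff_ennreal)
    qed
  qed
qed

section \<open>The past of a process\<close>

lemma past_algebra_generators:
  "{w i -` U \<inter> space M |i U. 1 \<le> i \<and> i \<le> n \<and> U \<in> sets borel} \<subseteq> Pow (space M)"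
  by auto

lemma space_past_algebra [simp]: "space (past_algebra M w n) = space M"
  unfolding past_algebra_def by (rule space_measure_of[OF past_algebra_generators])

lemma past_algebra_mono: "m \<le> n \<Longrightarrow> sets (past_algebra M w m) \<subseteq> sets (past_algebra M w n)"
  unfolding past_algebra_def sets_measure_of[OF past_algebra_generators]
  by (rule sigma_sets_mono') fastforce

lemma rand_var_past_algebra:
  assumes "1 \<le> i" "i \<le> n" "rand_var M (w i)"
  shows "rand_var (past_algebra M w n) (w i)"
proof -
  have "w i -` U \<inter> space M \<in> sets (past_algebra M w n)" if "U \<in> sets borel" for U
    unfolding past_algebra_def using assms that
    by (intro in_measure_of[OF past_algebra_generators]) blast
  then have "w i \<in> borel_measurable (past_algebra M w n)"
    by (intro measurableI) auto
  then show ?thesis using assms(3) by (auto simp: rand_var_def)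
qed

section \<open>The forward-backward step\<close>

lemma cocoercive_inner_nonneg:
  assumes "0 < \<beta>" "cocoercive \<beta> B"
  shows "0 \<le> inner (x - y) (B x - B y)"
proof -
  have "0 \<le> \<beta> * (norm (B x - B y))\<^sup>2" using assms(1) by simp
  then show ?thesis using assms(2) unfolding cocoercive_def by (meson order_trans)
qed

lemma cocoercive_lipschitz:
  assumes \<beta>: "0 < \<beta>" and B: "cocoercive \<beta> B"
  shows "norm (B x - B y) \<le> norm (x - y) / \<beta>"
proof (cases "B x = B y")
  case False
  have "\<beta> * (norm (B x - B y))\<^sup>2 \<le> norm (x - y) * norm (B x - B y)"
    using B norm_cauchy_schwarz[of "x - y" "B x - B y"] unfolding cocoercive_def by (meson order_trans)
  then have "norm (B x - B y) * (\<beta> * norm (B x - B y)) \<le> norm (B x - B y) * norm (x - y)"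
    by (simp add: power2_eq_square mult_ac)
  then have "\<beta> * norm (B x - B y) \<le> norm (x - y)"
    using False by simp
  then show ?thesis using \<beta> by (simp add: field_simps)
qed (use \<beta> in simp)

lemma lipschitz_imp_continuous_on:
  fixes f :: "'a::real_normed_vector \<Rightarrow> 'b::real_normed_vector"
  assumes "0 \<le> C" "\<And>x y. norm (f x - f y) \<le> C * norm (x - y)"
  shows "continuous_on UNIV f"
  by (rule lipschitz_on_continuous_on[where L = C])
     (use assms in \<open>auto intro!: lipschitz_onI simp: dist_norm\<close>)

lemma zer_sum_iff: "v \<in> zer_sum A B \<longleftrightarrow> - B v \<in> A v"
  by (auto simp: zer_sum_def) (metis add_eq_0_iff2 add.inverse_inverse add.right_inverse)+

text \<open>
Monotonicity of \<open>A\<close> applied to \<open>- B v\<close> and \<open>- B v'\<close> gives the inequality opposite to cocoercivity.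
\<close>

lemma cocoercive_constant_on_zer_sum:
  assumes "monotone_op A" and \<beta>: "0 < \<beta>" and B: "cocoercive \<beta> B"
    and v: "v \<in> zer_sum A B" "v' \<in> zer_sum A B"
  shows "B v = B v'"
proof -
  have "0 \<le> inner (v - v') (- B v - - B v')"
    using v by (intro monotone_opD[OF assms(1)]) (simp_all add: zer_sum_iff)
  also have "\<dots> = - inner (v - v') (B v - B v')"
    by (simp add: inner_diff_right)
  finally have "\<beta> * (norm (B v - B v'))\<^sup>2 \<le> 0"
    using B unfolding cocoercive_def by (smt (verit))
  then show ?thesis using \<beta> by (simp add: mult_le_0_iff)
qed

lemma forward_backward_fixed_point:
  assumes "maximally_monotone A" "0 < \<gamma>" "v \<in> zer_sum A B"
  shows "resolvent \<gamma> A (v - \<gamma> *\<^sub>R B v) = v"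
  using resolvent_eq[OF assms(1,2), of "- B v" v] assms(3) by (simp add: zer_sum_iff)

lemma norm_convex_combination_power2_le:
  assumes "0 \<le> l" "l \<le> 1"
  shows "(norm ((1 - l) *\<^sub>R a + l *\<^sub>R c))\<^sup>2 \<le> (1 - l) * (norm a)\<^sup>2 + l * (norm (c::'h::real_inner))\<^sup>2"
proof -
  have "(1 - l) * (norm a)\<^sup>2 + l * (norm c)\<^sup>2 - (norm ((1 - l) *\<^sub>R a + l *\<^sub>R c))\<^sup>2
      = l * (1 - l) * (norm (a - c))\<^sup>2"
    by (simp add: power2_norm_eq_inner inner_add_left inner_add_right inner_diff_left
           inner_diff_right inner_commute algebra_simps)
  moreover have "0 \<le> l * (1 - l) * (norm (a - c))\<^sup>2" using assms by simp
  ultimately show ?thesis by linarith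
qed

text \<open>
The deterministic part of one step. The estimate \<open>b\<close> of \<open>B x\<close> enters only through the error \<open>b - B x\<close>,
once squared and once linearly against a vector that is determined by \<open>x\<close>.
\<close>

lemma relaxed_resolvent_step_le:
  fixes A :: "'h::{real_inner, complete_space} \<Rightarrow> 'h set"
  assumes A: "maximally_monotone A" and \<gamma>: "0 < \<gamma>" and l: "0 \<le> l" "l \<le> 1"
    and v: "v \<in> zer_sum A B"
  shows "(norm ((1 - l) *\<^sub>R x + l *\<^sub>R resolvent \<gamma> A (x - \<gamma> *\<^sub>R b) - v))\<^sup>2
    \<le> (norm (x - v))\<^sup>2 - 2 * l * \<gamma> * inner (x - v) (B x - B v) + l * \<gamma>\<^sup>2 * (norm (B x - B v))\<^sup>2
      + l * \<gamma>\<^sup>2 * (norm (b - B x))\<^sup>2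
      + inner (b - B x) ((2 * l * \<gamma>\<^sup>2) *\<^sub>R (B x - B v) - (2 * l * \<gamma>) *\<^sub>R (x - v))"
proof -
  let ?J = "resolvent \<gamma> A (x - \<gamma> *\<^sub>R b)"
  define p d e where "p = x - v" and "d = B x - B v" and "e = b - B x"
  have eq: "(x - \<gamma> *\<^sub>R b) - (v - \<gamma> *\<^sub>R B v) = p - \<gamma> *\<^sub>R (d + e)"
    by (simp add: p_def d_def e_def algebra_simps)
  have "norm (?J - v) \<le> norm (p - \<gamma> *\<^sub>R (d + e))"
    using resolvent_nonexpansive[OF A \<gamma>, of "x - \<gamma> *\<^sub>R b" "v - \<gamma> *\<^sub>R B v"]
    unfolding forward_backward_fixed_point[OF A \<gamma> v] eq .
  then have "l * (norm (?J - v))\<^sup>2 \<le> l * (norm (p - \<gamma> *\<^sub>R (d + e)))\<^sup>2"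
    using l by (intro mult_left_mono power_mono) auto
  moreover have "(norm ((1 - l) *\<^sub>R x + l *\<^sub>R ?J - v))\<^sup>2 \<le> (1 - l) * (norm p)\<^sup>2 + l * (norm (?J - v))\<^sup>2"
  proof -
    have "(1 - l) *\<^sub>R x + l *\<^sub>R ?J - v = (1 - l) *\<^sub>R p + l *\<^sub>R (?J - v)"
      by (simp add: p_def algebra_simps)
    then show ?thesis using norm_convex_combination_power2_le[OF l] by metis
  qed
  moreover have "(1 - l) * (norm p)\<^sup>2 + l * (norm (p - \<gamma> *\<^sub>R (d + e)))\<^sup>2
    = (norm p)\<^sup>2 - 2 * l * \<gamma> * inner p d + l * \<gamma>\<^sup>2 * (norm d)\<^sup>2 + l * \<gamma>\<^sup>2 * (norm e)\<^sup>2
      + inner e ((2 * l * \<gamma>\<^sup>2) *\<^sub>R d - (2 * l * \<gamma>) *\<^sub>R p)"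
    unfolding power2_norm_eq_inner
    by (simp add: inner_add_left inner_add_right inner_diff_left inner_diff_right inner_commute
        algebra_simps) (simp add: power2_eq_square algebra_simps)
  ultimately show ?thesis unfolding p_def d_def e_def by linarith
qed

text \<open>
Splitting \<open>\<parallel>B x\<parallel>\<^sup>2 \<le> 2 \<parallel>B x - B v\<parallel>\<^sup>2 + 2 \<parallel>B v\<parallel>\<^sup>2\<close> collects the factor
\<open>l \<gamma>\<^sup>2 (1 + 2 \<sigma>\<^sup>2 \<alpha>)\<close> in front of \<open>\<parallel>B x - B v\<parallel>\<^sup>2\<close>. The bound on \<open>\<gamma>\<close> and cocoercivity turn it into
\<open>(2 - \<epsilon>) l \<gamma>\<close> times the inner product, which leaves \<open>- \<epsilon> l \<gamma>\<close> of the descent term.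
\<close>

lemma step_size_drift_le:
  fixes B :: "'h::real_inner \<Rightarrow> 'h"
  assumes B: "cocoercive \<beta> B" and \<gamma>: "0 < \<gamma>" and l: "0 \<le> l" and \<alpha>: "0 \<le> \<alpha>" and \<beta>: "0 < \<beta>"
    and bound: "\<gamma> \<le> (2 - \<epsilon>) * \<beta> / (1 + 2 * \<sigma>\<^sup>2 * \<alpha>)"
  shows "- (2 * l * \<gamma> * inner (x - v) (B x - B v)) + l * \<gamma>\<^sup>2 * (norm (B x - B v))\<^sup>2
      + l * \<gamma>\<^sup>2 * (\<sigma>\<^sup>2 * (1 + \<alpha> * (norm (B x))\<^sup>2))
    \<le> - (\<epsilon> * (l * \<gamma> * inner (x - v) (B x - B v))) + \<sigma>\<^sup>2 * (l * \<gamma>\<^sup>2 * (1 + 2 * \<alpha> * (norm (B v))\<^sup>2))"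
proof -
  define I D where "I = inner (x - v) (B x - B v)" and "D = (norm (B x - B v))\<^sup>2"
  have D0: "0 \<le> D" by (simp add: D_def)
  have ID: "\<beta> * D \<le> I" using B by (auto simp: I_def D_def cocoercive_def)
  have pos: "0 < 1 + 2 * \<sigma>\<^sup>2 * \<alpha>" using \<alpha> by (simp add: add_pos_nonneg)
  have g: "\<gamma> * (1 + 2 * \<sigma>\<^sup>2 * \<alpha>) \<le> (2 - \<epsilon>) * \<beta>"
    using bound pos by (simp add: field_simps)
  moreover have "0 < \<gamma> * (1 + 2 * \<sigma>\<^sup>2 * \<alpha>)" using \<gamma> pos by simp
  ultimately have \<epsilon>2: "0 \<le> 2 - \<epsilon>"
    using \<beta> by (metis mult_le_0_iff mult_neg_pos not_le order_less_le_trans order_less_imp_le)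
  have "(\<gamma> * (1 + 2 * \<sigma>\<^sup>2 * \<alpha>)) * D \<le> ((2 - \<epsilon>) * \<beta>) * D"
    using g D0 by (rule mult_right_mono)
  also have "\<dots> \<le> (2 - \<epsilon>) * I"
    using mult_left_mono[OF ID \<epsilon>2] by (simp add: mult_ac)
  finally have main: "(l * \<gamma>) * ((\<gamma> * (1 + 2 * \<sigma>\<^sup>2 * \<alpha>)) * D) \<le> (l * \<gamma>) * ((2 - \<epsilon>) * I)"
    using l \<gamma> by (intro mult_left_mono) auto
  have "(norm (B x))\<^sup>2 \<le> (norm (B x - B v) + norm (B v))\<^sup>2"
    using norm_triangle_sub[of "B x" "B v"] by (intro power_mono) (auto simp: add.commute)
  also have "\<dots> \<le> 2 * D + 2 * (norm (B v))\<^sup>2"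
    using sum_squares_bound[of "norm (B x - B v)" "norm (B v)"] by (simp add: power2_sum D_def)
  finally have "(l * \<gamma>\<^sup>2 * \<sigma>\<^sup>2 * \<alpha>) * (norm (B x))\<^sup>2 \<le> (l * \<gamma>\<^sup>2 * \<sigma>\<^sup>2 * \<alpha>) * (2 * D + 2 * (norm (B v))\<^sup>2)"
    using l \<alpha> by (intro mult_left_mono) auto
  with main show ?thesis
    unfolding I_def[symmetric] D_def[symmetric] by (simp add: power2_eq_square algebra_simps)
qed

lemma (in finite_measure) square_integrable_const: "square_integrable M (\<lambda>_. c)"
  by (simp add: square_integrable_def)

lemma square_integrable_scaleR: "square_integrable M f \<Longrightarrow> square_integrable M (\<lambda>\<omega>. c *\<^sub>R f \<omega>)"
  by (simp add: square_integrable_def power_mult_distrib)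

lemma square_integrable_diff:
  assumes "rand_var M f" "rand_var M g" "square_integrable M f" "square_integrable M g"
  shows "square_integrable M (\<lambda>\<omega>. f \<omega> - g \<omega>)"
  by (rule square_integrable_dominated[OF rand_var_diff[OF assms(1,2)] assms(3,4)])
     (rule norm_triangle_ineq4)

lemma square_integrable_indicator_scaleR:
  assumes "E \<in> sets M" "rand_var M f" "square_integrable M f"
  shows "square_integrable M (\<lambda>\<omega>. indicator E \<omega> *\<^sub>R f \<omega>)"
  by (rule square_integrable_dominated[OF rand_var_indicator_scaleR[OF assms(1,2)] assms(3,3)])
     (auto simp: indicator_def)

lemma (in finite_measure) square_integrable_lipschitz:
  fixes f :: "'b::real_normed_vector \<Rightarrow> 'c::real_normed_vector"
  assumes "0 \<le> C" "\<And>x y. norm (f x - f y) \<le> C * norm (x - y)"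
    and "rand_var M X" "square_integrable M X"
  shows "square_integrable M (\<lambda>\<omega>. f (X \<omega>))"
proof (rule square_integrable_dominated[where f = "\<lambda>\<omega>. C *\<^sub>R X \<omega>" and g = "\<lambda>_. f 0"])
  show "rand_var M (\<lambda>\<omega>. f (X \<omega>))"
    by (rule rand_var_continuous_on[OF assms(3) lipschitz_imp_continuous_on[OF assms(1,2)]])
  show "norm (f (X \<omega>)) \<le> norm (C *\<^sub>R X \<omega>) + norm (f 0)" for \<omega>
    using assms(2)[of "X \<omega>" 0] norm_triangle_sub[of "f (X \<omega>)" "f 0"] assms(1) by simp
qed (intro square_integrable_scaleR square_integrable_const assms)+

text \<open>
The integrated form of the descent inequality over an event of the past. The linear noise term vanishes
by \<open>is_cond_exp_orthogonal\<close>, because the indicator of \<open>E\<close> can be moved to the \<open>F\<close>-measurable factor.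
\<close>

lemma (in prob_space) forward_backward_step_expectation_le:
  fixes A :: "'h::{real_inner, complete_space} \<Rightarrow> 'h set"
  assumes A: "maximally_monotone A" and \<beta>: "0 < \<beta>" and B: "cocoercive \<beta> B"
    and \<gamma>: "0 < \<gamma>" and l: "0 \<le> l" "l \<le> 1" and \<alpha>: "0 \<le> \<alpha>"
    and ce: "is_cond_exp M F b (\<lambda>\<omega>. B (x \<omega>))"
    and x: "rand_var F x"
    and sq: "square_integrable M x" "square_integrable M b"
    and var: "AE \<omega> in M. nn_cond_exp M F (\<lambda>\<omega>. ennreal ((norm (b \<omega> - B (x \<omega>)))\<^sup>2)) \<omega>
        \<le> ennreal (\<sigma>\<^sup>2 * (1 + \<alpha> * (norm (B (x \<omega>)))\<^sup>2))"
    and bound: "\<gamma> \<le> (2 - \<epsilon>) * \<beta> / (1 + 2 * \<sigma>\<^sup>2 * \<alpha>)"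
    and x': "\<And>\<omega>. \<omega> \<in> space M \<Longrightarrow>
       x' \<omega> = (1 - l) *\<^sub>R x \<omega> + l *\<^sub>R resolvent \<gamma> A (x \<omega> - \<gamma> *\<^sub>R b \<omega>)"
      "rand_var M x'" "square_integrable M x'"
    and v: "v \<in> zer_sum A B" and E: "E \<in> sets F"
  shows "(\<integral>\<omega>. indicator E \<omega> * (norm (x' \<omega> - v))\<^sup>2 \<partial>M)
    \<le> (\<integral>\<omega>. indicator E \<omega> * ((norm (x \<omega> - v))\<^sup>2 - \<epsilon> * (l * \<gamma> * inner (x \<omega> - v) (B (x \<omega>) - B v))
          + \<sigma>\<^sup>2 * (l * \<gamma>\<^sup>2 * (1 + 2 * \<alpha> * (norm (B v))\<^sup>2))) \<partial>M)"
proof -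
  have sub: "subalgebra M F" and bM: "rand_var M b" and BxF: "rand_var F (\<lambda>\<omega>. B (x \<omega>))"
    using ce by (auto simp: is_cond_exp_def integrable_rand_var_def)
  interpret finite_measure_subalgebra M F by unfold_locales (rule sub)
  note toM = rand_var_from_subalgebra[OF sub]
  have EM [measurable]: "E \<in> sets M" using E sub by (auto simp: subalgebra_def)
  define p d e where "p = (\<lambda>\<omega>. x \<omega> - v)" and "d = (\<lambda>\<omega>. B (x \<omega>) - B v)" and "e = (\<lambda>\<omega>. b \<omega> - B (x \<omega>))"
  define h where "h = (\<lambda>\<omega>. (2 * l * \<gamma>\<^sup>2) *\<^sub>R d \<omega> - (2 * l * \<gamma>) *\<^sub>R p \<omega>)"
  have sqB: "square_integrable M (\<lambda>\<omega>. B (x \<omega>))"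
    by (rule square_integrable_lipschitz[where C = "1 / \<beta>"])
       (use \<beta> cocoercive_lipschitz[OF \<beta> B] toM[OF x] sq in auto)
  have rF: "rand_var F p" "rand_var F d"
    unfolding p_def d_def by (intro rand_var_diff rand_var_const x BxF)+
  have rM: "rand_var M p" "rand_var M d" "rand_var M e"
    using toM[OF rF(1)] toM[OF rF(2)] rand_var_diff[OF bM toM[OF BxF]] by (simp_all add: e_def)
  have sqs: "square_integrable M p" "square_integrable M d" "square_integrable M e"
    unfolding p_def d_def e_def
    by (intro square_integrable_diff square_integrable_const rand_var_const toM[OF x] toM[OF BxF] bM sq sqB)+
  have hF: "rand_var F h"
    unfolding h_def by (intro rand_var_diff rand_var_scaleR rF)
  have sqh: "square_integrable M h"
    unfolding h_def by (intro square_integrable_diff square_integrable_scaleR rand_var_scaleR rM sqs)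
  \<comment> \<open>\<open>indicator E *\<^sub>R h\<close> is again measurable with respect to \<open>F\<close>\<close>
  have orth: "(\<integral>\<omega>. inner (e \<omega>) (indicator E \<omega> *\<^sub>R h \<omega>) \<partial>M) = 0"
    unfolding e_def
    by (intro is_cond_exp_orthogonal[OF ce] rand_var_indicator_scaleR E hF sq sqB
        square_integrable_indicator_scaleR EM toM[OF hF] sqh)
  have int_eh: "integrable M (\<lambda>\<omega>. inner (e \<omega>) (indicator E \<omega> *\<^sub>R h \<omega>))"
    by (intro square_integrable_inner_integrable rM sqs rand_var_indicator_scaleR EM toM[OF hF]
        square_integrable_indicator_scaleR sqh)
  have int2 [simp]: "integrable M (\<lambda>\<omega>. (norm (p \<omega>))\<^sup>2)" "integrable M (\<lambda>\<omega>. (norm (d \<omega>))\<^sup>2)"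
    "integrable M (\<lambda>\<omega>. (norm (e \<omega>))\<^sup>2)" "integrable M (\<lambda>\<omega>. (norm (B (x \<omega>)))\<^sup>2)"
    using sqs sqB by (simp_all add: square_integrable_def)
  have intI [simp]: "integrable M (\<lambda>\<omega>. inner (p \<omega>) (d \<omega>))"
    by (intro square_integrable_inner_integrable rM sqs)
  have intx' [simp]: "integrable M (\<lambda>\<omega>. (norm (x' \<omega> - v))\<^sup>2)"
    using square_integrable_diff[OF x'(2) rand_var_const x'(3) square_integrable_const]
    by (simp add: square_integrable_def)
  have intE: "integrable M (\<lambda>\<omega>. indicator E \<omega> * f \<omega>)" if "integrable M f" for f :: "'a \<Rightarrow> real"
    using integrable_mult_indicator[OF EM that] by simp
  define Q where "Q = (\<lambda>\<omega>. \<sigma>\<^sup>2 * (1 + \<alpha> * (norm (B (x \<omega>)))\<^sup>2))"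
  define R where "R = (\<lambda>\<omega>. (norm (p \<omega>))\<^sup>2 - 2 * l * \<gamma> * inner (p \<omega>) (d \<omega>) + l * \<gamma>\<^sup>2 * (norm (d \<omega>))\<^sup>2)"
  have intQ [simp]: "integrable M Q" and intR [simp]: "integrable M R"
    by (simp_all add: Q_def R_def)
  have Q0: "0 \<le> Q \<omega>" for \<omega> using \<alpha> by (simp add: Q_def)
  have noise: "(\<integral>\<omega>. indicator E \<omega> * (norm (e \<omega>))\<^sup>2 \<partial>M) \<le> (\<integral>\<omega>. indicator E \<omega> * Q \<omega> \<partial>M)"
  proof -
    have ind: "indicator E \<omega> * ennreal (f \<omega>) = ennreal (indicator E \<omega> * f \<omega>)" for f \<omega>
      by (auto simp: indicator_def)
    have nn: "(\<integral>\<^sup>+\<omega>. indicator E \<omega> * ennreal (f \<omega>) \<partial>M) = ennreal (\<integral>\<omega>. indicator E \<omega> * f \<omega> \<partial>M)"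
      if "integrable M f" "\<And>\<omega>. 0 \<le> f \<omega>" for f
      unfolding ind using that intE[OF that(1)] by (intro nn_integral_eq_integral AE_I2) auto
    have meas: "(\<lambda>\<omega>. ennreal ((norm (e \<omega>))\<^sup>2)) \<in> borel_measurable M"
      using rand_var_norm_measurable[OF rM(3)] by measurable
    have "ennreal (\<integral>\<omega>. indicator E \<omega> * (norm (e \<omega>))\<^sup>2 \<partial>M)
        = (\<integral>\<^sup>+\<omega>. indicator E \<omega> * ennreal ((norm (e \<omega>))\<^sup>2) \<partial>M)"
      by (rule nn[symmetric]) auto
    also have "\<dots> = (\<integral>\<^sup>+\<omega>. indicator E \<omega> * nn_cond_exp M F (\<lambda>\<omega>. ennreal ((norm (e \<omega>))\<^sup>2)) \<omega> \<partial>M)"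
      by (rule nn_cond_exp_intg[symmetric, OF _ meas]) (use E in measurable)
    also have "\<dots> \<le> (\<integral>\<^sup>+\<omega>. indicator E \<omega> * ennreal (Q \<omega>) \<partial>M)"
      by (rule nn_integral_mono_AE, rule AE_mp[OF var]) (auto simp: e_def Q_def intro!: AE_I2 mult_left_mono)
    also have "\<dots> = ennreal (\<integral>\<omega>. indicator E \<omega> * Q \<omega> \<partial>M)"
      by (rule nn[of Q, OF intQ Q0])
    finally show ?thesis
      using Q0 by (subst (asm) ennreal_le_iff) (auto intro!: Bochner_Integration.integral_nonneg)
  qed
  have "(\<integral>\<omega>. indicator E \<omega> * (norm (x' \<omega> - v))\<^sup>2 \<partial>M)
    \<le> (\<integral>\<omega>. indicator E \<omega> * R \<omega> + (l * \<gamma>\<^sup>2) * (indicator E \<omega> * (norm (e \<omega>))\<^sup>2)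
          + inner (e \<omega>) (indicator E \<omega> *\<^sub>R h \<omega>) \<partial>M)"
  proof (rule integral_mono)
    fix \<omega> assume "\<omega> \<in> space M"
    then show "indicator E \<omega> * (norm (x' \<omega> - v))\<^sup>2 \<le> indicator E \<omega> * R \<omega>
        + (l * \<gamma>\<^sup>2) * (indicator E \<omega> * (norm (e \<omega>))\<^sup>2) + inner (e \<omega>) (indicator E \<omega> *\<^sub>R h \<omega>)"
      using relaxed_resolvent_step_le[OF A \<gamma> l v, of "x \<omega>" "b \<omega>"] x'(1)[of \<omega>]
      by (cases "\<omega> \<in> E") (simp_all add: R_def e_def h_def p_def d_def)
  qed (intro Bochner_Integration.integrable_add Bochner_Integration.integrable_mult_right intE int_eh intx' intR int2)+
  also have "\<dots> = (\<integral>\<omega>. indicator E \<omega> * R \<omega> \<partial>M) + (l * \<gamma>\<^sup>2) * (\<integral>\<omega>. indicator E \<omega> * (norm (e \<omega>))\<^sup>2 \<partial>M)"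
    using intE[OF intR] intE[OF int2(3)] int_eh orth by simp
  also have "\<dots> \<le> (\<integral>\<omega>. indicator E \<omega> * R \<omega> \<partial>M) + (l * \<gamma>\<^sup>2) * (\<integral>\<omega>. indicator E \<omega> * Q \<omega> \<partial>M)"
    using noise l by (intro add_left_mono mult_left_mono) auto
  also have "\<dots> = (\<integral>\<omega>. indicator E \<omega> * R \<omega> + (l * \<gamma>\<^sup>2) * (indicator E \<omega> * Q \<omega>) \<partial>M)"
    using intE[OF intR] intE[OF intQ] by simp
  also have "\<dots> \<le> (\<integral>\<omega>. indicator E \<omega> * ((norm (p \<omega>))\<^sup>2 - \<epsilon> * (l * \<gamma> * inner (p \<omega>) (d \<omega>))
          + \<sigma>\<^sup>2 * (l * \<gamma>\<^sup>2 * (1 + 2 * \<alpha> * (norm (B v))\<^sup>2))) \<partial>M)"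
  proof (rule integral_mono)
    fix \<omega>
    show "indicator E \<omega> * R \<omega> + (l * \<gamma>\<^sup>2) * (indicator E \<omega> * Q \<omega>)
      \<le> indicator E \<omega> * ((norm (p \<omega>))\<^sup>2 - \<epsilon> * (l * \<gamma> * inner (p \<omega>) (d \<omega>))
          + \<sigma>\<^sup>2 * (l * \<gamma>\<^sup>2 * (1 + 2 * \<alpha> * (norm (B v))\<^sup>2)))"
      using step_size_drift_le[OF B \<gamma> l(1) \<alpha> \<beta> bound, of "x \<omega>" v]
      by (cases "\<omega> \<in> E") (simp_all add: R_def Q_def p_def d_def)
    show "integrable M (\<lambda>\<omega>. indicator E \<omega> * ((norm (p \<omega>))\<^sup>2 - \<epsilon> * (l * \<gamma> * inner (p \<omega>) (d \<omega>))
          + \<sigma>\<^sup>2 * (l * \<gamma>\<^sup>2 * (1 + 2 * \<alpha> * (norm (B v))\<^sup>2))))"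
      by (intro intE) simp
  qed (intro Bochner_Integration.integrable_add Bochner_Integration.integrable_mult_right intE intR intQ)
  finally show ?thesis by (simp add: p_def d_def)
qed

section \<open>Cluster points along a trajectory\<close>

text \<open>
If \<open>g\<close> were eventually bounded away from zero, the weights themselves would be summable.
\<close>

lemma weighted_summable_imp_null_subsequence:
  fixes a g :: "nat \<Rightarrow> real"
  assumes a: "\<And>n. 0 \<le> a n" "\<not> summable a" and g: "\<And>n. 0 \<le> g n" and s: "summable (\<lambda>n. a n * g n)"
  obtains t where "strict_mono t" "(\<lambda>n. g (t n)) \<longlonglongrightarrow> 0"
proof -
  have ex: "\<exists>n\<ge>N. g n < e" if e: "0 < e" for e N
  proof (rule ccontr)
    assume "\<not> ?thesis"
    then have ge: "e \<le> g n" if "N \<le> n" for n using that by force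
    have "summable a"
    proof (rule summable_comparison_test)
      show "summable (\<lambda>n. (1 / e) * (a n * g n))" using s by (rule summable_mult)
      have "norm (a n) \<le> (1 / e) * (a n * g n)" if "N \<le> n" for n
        using mult_left_mono[OF ge[OF that] a(1)[of n]] a(1)[of n] e by (simp add: field_simps)
      then show "\<exists>N. \<forall>n\<ge>N. norm (a n) \<le> (1 / e) * (a n * g n)" by blast
    qed
    then show False using a(2) by blast
  qed
  have "\<exists>t. \<forall>n. g (t n) < 1 / real (Suc n) \<and> t n < t (Suc n)"
  proof (rule dependent_nat_choice)
    show "\<exists>x. g x < 1 / real (Suc 0)" using ex[of 1 0] by auto
    show "\<exists>y. g y < 1 / real (Suc (Suc n)) \<and> x < y" for x n
      using ex[of "1 / real (Suc (Suc n))" "Suc x"] by (auto simp: Suc_le_eq)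
  qed
  then obtain t where t: "\<And>n. g (t n) < 1 / real (Suc n)" "\<And>n. t n < t (Suc n)" by blast
  have "(\<lambda>n. g (t n)) \<longlonglongrightarrow> 0"
  proof (rule tendsto_sandwich[OF _ _ tendsto_const])
    show "(\<lambda>n. 1 / real (Suc n)) \<longlonglongrightarrow> 0" by (rule LIMSEQ_Suc[OF lim_1_over_n])
    show "\<forall>\<^sub>F n in sequentially. g (t n) \<le> 1 / real (Suc n)"
      using t(1) by (auto intro!: always_eventually less_imp_le)
  qed (use g in simp)
  with t(2) show thesis by (intro that[of t]) (auto simp: strict_mono_Suc_iff)
qed

text \<open>
At distance at least \<open>e\<close> from \<open>l\<close> the inner product is at least \<open>\<phi> e\<close>, which is positive.
\<close>

lemma uniformly_monotone_at_tendsto: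
  assumes B: "uniformly_monotone_at B l" and lim: "(\<lambda>n. inner (x n - l) (B (x n) - B l)) \<longlonglongrightarrow> 0"
  shows "x \<longlonglongrightarrow> l"
proof (rule tendstoI)
  fix e :: real assume e: "0 < e"
  obtain \<phi> :: "real \<Rightarrow> ereal" where \<phi>: "mono_on {0..} \<phi>" "\<And>t. 0 \<le> t \<Longrightarrow> 0 \<le> \<phi> t"
      "\<And>t. 0 \<le> t \<Longrightarrow> \<phi> t = 0 \<longleftrightarrow> t = 0"
      "\<And>w. \<phi> (norm (w - l)) \<le> ereal (inner (w - l) (B w - B l))"
    using B unfolding uniformly_monotone_at_def by blast
  have "0 < \<phi> e" using \<phi>(2,3)[of e] e by (simp add: order_less_le)
  moreover have "(\<lambda>n. ereal (inner (x n - l) (B (x n) - B l))) \<longlonglongrightarrow> 0"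
    using lim by (simp add: zero_ereal_def)
  ultimately have "\<forall>\<^sub>F n in sequentially. ereal (inner (x n - l) (B (x n) - B l)) < \<phi> e"
    by (rule order_tendstoD(2)[rotated])
  then show "\<forall>\<^sub>F n in sequentially. dist (x n) l < e"
  proof eventually_elim
    case (elim n)
    show ?case
    proof (rule ccontr)
      assume "\<not> ?case"
      then have "\<phi> e \<le> \<phi> (norm (x n - l))"
        using \<phi>(1) e by (auto simp: monotone_on_def dist_norm)
      then show False using elim \<phi>(4)[of "x n"] by simp
    qed
  qed
qed

text \<open>
By cocoercivity \<open>B (x n)\<close> converges strongly to \<open>B l\<close>, whereas by weak continuity it converges weakly to
\<open>B k\<close> along a subsequence with weak limit \<open>k\<close>. Hence \<open>B k = B l\<close>, and strict monotonicity leaves only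
\<open>k = l\<close>.
\<close>

lemma strictly_monotone_at_weakly_convergent_subsequence:
  fixes x :: "nat \<Rightarrow> 'h::{real_inner, complete_space}"
  assumes \<beta>: "0 < \<beta>" and B: "cocoercive \<beta> B" "strictly_monotone_at B l" "weakly_continuous B"
    and bounded: "\<And>n. norm (x n) \<le> C"
    and lim: "(\<lambda>n. inner (x n - l) (B (x n) - B l)) \<longlonglongrightarrow> 0"
  obtains r where "strict_mono r" "weakly_converges (\<lambda>n. x (r n)) l"
proof -
  have "(\<lambda>n. (norm (B (x n) - B l))\<^sup>2) \<longlonglongrightarrow> 0"
  proof (rule tendsto_sandwich[OF _ _ tendsto_const])
    show "(\<lambda>n. inner (x n - l) (B (x n) - B l) / \<beta>) \<longlonglongrightarrow> 0"
      using tendsto_divide[OF lim tendsto_const, of \<beta>] \<beta> by simp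
    have "(norm (B (x n) - B l))\<^sup>2 \<le> inner (x n - l) (B (x n) - B l) / \<beta>" for n
      using B(1) \<beta> by (simp add: cocoercive_def field_simps)
    then show "\<forall>\<^sub>F n in sequentially. (norm (B (x n) - B l))\<^sup>2 \<le> inner (x n - l) (B (x n) - B l) / \<beta>"
      by (auto intro: always_eventually)
  qed simp
  then have "(\<lambda>n. norm (B (x n) - B l)) \<longlonglongrightarrow> 0"
    using tendsto_real_sqrt[of "\<lambda>n. (norm (B (x n) - B l))\<^sup>2" 0] by simp
  then have strong: "(\<lambda>n. B (x n)) \<longlonglongrightarrow> B l"
    by (simp add: tendsto_norm_zero_iff LIM_zero_iff)
  obtain r k where r: "strict_mono r" "weakly_converges (\<lambda>n. x (r n)) k"
    by (rule bounded_imp_weakly_convergent_subsequence[of x, OF bounded])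
  have "weakly_converges (\<lambda>n. B (x (r n))) (B k)"
    using continuous_map_limit[OF B(3)[unfolded weakly_continuous_def] r(2)[unfolded weakly_converges_def]]
    by (simp add: weakly_converges_def comp_def)
  then have weak: "(\<lambda>n. inner (B (x (r n))) u) \<longlonglongrightarrow> inner (B k) u" for u
    by (simp add: weakly_converges_iff)
  have "inner (B k) u = inner (B l) u" for u
  proof (rule LIMSEQ_unique[OF weak])
    show "(\<lambda>n. inner (B (x (r n))) u) \<longlonglongrightarrow> inner (B l) u"
      using LIMSEQ_subseq_LIMSEQ[OF strong r(1)] by (intro tendsto_intros) (simp add: comp_def)
  qed
  then have "B k = B l" by (metis inner_eq_zero_iff inner_diff_left eq_iff_diff_eq_0)
  then have "k = l" using B(2) unfolding strictly_monotone_at_def by (metis diff_self inner_zero_right less_irrefl)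
  with r show thesis using that by blast
qed

section \<open>Convergence of the stochastic forward-backward iteration\<close>

theorem theorem3p6:
  fixes M :: "'a measure"
    and A :: "'h::{real_inner, complete_space} \<Rightarrow> 'h set"
    and B :: "'h \<Rightarrow> 'h"
    and \<beta> \<sigma> :: real
    and wbar :: 'h
    and \<gamma> lam \<alpha> :: "nat \<Rightarrow> real"
    and BB w y z :: "nat \<Rightarrow> 'a \<Rightarrow> 'h"
  assumes "prob_space M"
    and "maximally_monotone A"
    and "\<beta> > 0"
    and "cocoercive \<beta> B"
    and "zer_sum A B \<noteq> {}"
    and "wbar \<in> zer_sum A B"
    and "\<forall>n\<ge>1. \<gamma> n > 0"
    and "\<forall>n\<ge>1. 0 \<le> lam n \<and> lam n \<le> 1"
    and "random_process M BB"
    and "\<forall>n\<ge>1. square_integrable M (BB n)"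
    and "rand_var M (w 1)"
    and "square_integrable M (w 1)"
    and "\<forall>n\<ge>1. \<forall>\<omega>\<in>space M. z n \<omega> = w n \<omega> - \<gamma> n *\<^sub>R BB n \<omega>"
    and "\<forall>n\<ge>1. \<forall>\<omega>\<in>space M. y n \<omega> = resolvent (\<gamma> n) A (z n \<omega>)"
    and "\<forall>n\<ge>1. \<forall>\<omega>\<in>space M. w (Suc n) \<omega> = (1 - lam n) *\<^sub>R w n \<omega> + lam n *\<^sub>R y n \<omega>"
    and cond1: "\<forall>n\<ge>1. is_cond_exp M (past_algebra M w n) (BB n) (\<lambda>\<omega>. B (w n \<omega>))"
    and cond2: "\<forall>n\<ge>1. \<alpha> n > 0" "\<sigma> > 0"
      "\<forall>n\<ge>1. AE \<omega> in M.
         nn_cond_exp M (past_algebra M w n) (\<lambda>\<omega>. ennreal ((norm (BB n \<omega> - B (w n \<omega>)))\<^sup>2)) \<omega>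
           \<le> ennreal (\<sigma>\<^sup>2 * (1 + \<alpha> n * (norm (B (w n \<omega>)))\<^sup>2))"
    and cond3: "\<exists>\<epsilon>>0. \<forall>n\<ge>1. \<gamma> n \<le> (2 - \<epsilon>) * \<beta> / (1 + 2 * \<sigma>\<^sup>2 * \<alpha> n)"
    and cond4: "filterlim (\<lambda>N. \<Sum>n=1..N. lam n * \<gamma> n) at_top sequentially"
      "summable (\<lambda>n. lam (Suc n) * (\<gamma> (Suc n))\<^sup>2 * (1 + 2 * \<alpha> (Suc n) * (norm (B wbar))\<^sup>2))"
  shows "stoch_quasi_Fejer M w (zer_sum A B)
    \<and> (\<exists>\<zeta> :: 'a \<Rightarrow> real. integrable M \<zeta> \<and>
         (AE \<omega> in M. (\<lambda>n. (norm (w n \<omega> - wbar))\<^sup>2) \<longlonglongrightarrow> \<zeta> \<omega>))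
    \<and> (uniformly_monotone_at B wbar \<longrightarrow> (AE \<omega> in M. (\<lambda>n. w n \<omega>) \<longlonglongrightarrow> wbar))
    \<and> (strictly_monotone_at B wbar \<and> weakly_continuous B \<longrightarrow>
         (\<exists>\<Omega>1\<in>sets M. measure M \<Omega>1 = 1 \<and>
            (\<forall>\<omega>\<in>\<Omega>1. \<exists>t :: nat \<Rightarrow> nat. strict_mono t \<and> (\<forall>n. t n \<ge> 1) \<and>
               weakly_converges (\<lambda>n. w (t n) \<omega>) wbar)))"
proof -
  interpret prob_space M by fact
  note A = assms(2) and \<beta> = assms(3) and B = assms(4) and wbar = assms(6)
  have \<gamma>: "0 < \<gamma> n" and lam: "0 \<le> lam n" "lam n \<le> 1" and \<alpha>: "0 \<le> \<alpha> n" if "1 \<le> n" for n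
    using assms(7,8) cond2(1) that by (auto simp: less_imp_le)
  have BB: "rand_var M (BB n)" "square_integrable M (BB n)" if "1 \<le> n" for n
    using assms(9,10) that by (auto simp: random_process_def integrable_rand_var_def)
  obtain \<epsilon> where \<epsilon>: "0 < \<epsilon>" "\<And>n. 1 \<le> n \<Longrightarrow> \<gamma> n \<le> (2 - \<epsilon>) * \<beta> / (1 + 2 * \<sigma>\<^sup>2 * \<alpha> n)"
    using cond3 by blast
  have sub: "subalgebra M (past_algebra M w n)" if "1 \<le> n" for n
    using cond1 that by (auto simp: is_cond_exp_def)
  have w_Suc: "w (Suc n) \<omega> = (1 - lam n) *\<^sub>R w n \<omega> + lam n *\<^sub>R resolvent (\<gamma> n) A (w n \<omega> - \<gamma> n *\<^sub>R BB n \<omega>)"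
    if "1 \<le> n" "\<omega> \<in> space M" for n \<omega>
    using assms(13-15) that by simp

  \<comment> \<open>the resolvent is nonexpansive, so square integrability propagates along the iteration\<close>
  have w_rv: "rand_var M (w n) \<and> square_integrable M (w n)" if "1 \<le> n" for n
    using that
  proof (induction n rule: dec_induct)
    case base
    then show ?case using assms(11,12) by simp
  next
    case (step n)
    let ?J = "resolvent (\<gamma> n) A" and ?u = "\<lambda>\<omega>. w n \<omega> - \<gamma> n *\<^sub>R BB n \<omega>"
    have nonexp: "norm (?J a - ?J b) \<le> 1 * norm (a - b)" for a b
      using resolvent_nonexpansive[OF A \<gamma>[OF step(1)]] by simp
    have u: "rand_var M ?u" "square_integrable M ?u"
      using step BB[OF step(1)]
      by (auto intro!: rand_var_diff rand_var_scaleR square_integrable_diff square_integrable_scaleR)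
    have J: "rand_var M (\<lambda>\<omega>. ?J (?u \<omega>))" "square_integrable M (\<lambda>\<omega>. ?J (?u \<omega>))"
      by (rule rand_var_continuous_on[OF u(1) lipschitz_imp_continuous_on[OF _ nonexp]], simp)
         (rule square_integrable_lipschitz[OF _ nonexp u], simp)
    have rv: "rand_var M (w (Suc n))"
      by (subst rand_var_cong[OF w_Suc[OF step(1)]], assumption)
         (intro rand_var_add rand_var_scaleR J conjunct1[OF step.IH])
    have "square_integrable M (w (Suc n))"
    proof (rule square_integrable_dominated[OF rv square_integrable_scaleR square_integrable_scaleR])
      show "norm (w (Suc n) \<omega>) \<le> norm ((1 - lam n) *\<^sub>R w n \<omega>) + norm (lam n *\<^sub>R ?J (?u \<omega>))"
        if "\<omega> \<in> space M" for \<omega>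
        unfolding w_Suc[OF step(1) that] by (rule norm_triangle_ineq)
    qed (use step J in auto)
    with rv show ?case ..
  qed

  \<comment> \<open>the error sequence, which serves all zeros at once by \<open>B_zer\<close> below\<close>
  define c where "c n = \<sigma>\<^sup>2 * (lam n * (\<gamma> n)\<^sup>2 * (1 + 2 * \<alpha> n * (norm (B wbar))\<^sup>2))" for n
  define G where "G v n \<omega> = lam n * \<gamma> n * inner (w n \<omega> - v) (B (w n \<omega>) - B v)" for v n \<omega>
  have c0: "0 \<le> c n" if "1 \<le> n" for n
    using lam[OF that] \<alpha>[OF that] by (simp add: c_def)
  have c_sum: "summable (\<lambda>n. c (Suc n))"
    unfolding c_def by (intro summable_mult cond4(2))
  have G0: "0 \<le> G v n \<omega>" if "1 \<le> n" for v n \<omega>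
    using lam[OF that] \<gamma>[OF that] cocoercive_inner_nonneg[OF \<beta> B] by (simp add: G_def)
  have B_zer: "B v = B wbar" if "v \<in> zer_sum A B" for v
    using cocoercive_constant_on_zer_sum[OF _ \<beta> B that wbar] A by (simp add: maximally_monotone_def)
  have dist_int: "integrable M (\<lambda>\<omega>. (norm (w n \<omega> - v))\<^sup>2)" if "1 \<le> n" for n v
    using square_integrable_diff[OF _ rand_var_const _ square_integrable_const] w_rv[OF that]
    by (auto simp: square_integrable_def)
  have dist_meas: "(\<lambda>\<omega>. (norm (w n \<omega> - v))\<^sup>2) \<in> borel_measurable (past_algebra M w n)" if "1 \<le> n" for n v
    using that w_rv[OF that]
    by (intro borel_measurable_power rand_var_norm_measurable rand_var_diff rand_var_const rand_var_past_algebra) auto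
  have G_int: "integrable M (G v n)" if n: "1 \<le> n" for v n
  proof -
    have Bw: "rand_var M (\<lambda>\<omega>. B (w n \<omega>))"
      using cond1 n by (auto simp: is_cond_exp_def integrable_rand_var_def)
    have "square_integrable M (\<lambda>\<omega>. B (w n \<omega>))"
      by (rule square_integrable_lipschitz[where C = "1 / \<beta>"])
         (use \<beta> cocoercive_lipschitz[OF \<beta> B] w_rv[OF n] in auto)
    with Bw w_rv[OF n] show ?thesis
      unfolding G_def[abs_def]
      by (intro Bochner_Integration.integrable_mult_right square_integrable_inner_integrable
          rand_var_diff rand_var_const square_integrable_diff square_integrable_const) auto
  qed
  have step: "(\<integral>\<omega>. indicator E \<omega> * (norm (w (Suc n) \<omega> - v))\<^sup>2 \<partial>M)
      \<le> (\<integral>\<omega>. indicator E \<omega> * ((norm (w n \<omega> - v))\<^sup>2 - \<epsilon> * G v n \<omega> + c n) \<partial>M)"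
    if n: "1 \<le> n" and v: "v \<in> zer_sum A B" and E: "E \<in> sets (past_algebra M w n)" for n v E
    unfolding c_def G_def B_zer[OF v, symmetric]
  proof (rule forward_backward_step_expectation_le[OF A \<beta> B \<gamma>[OF n] lam[OF n] \<alpha>[OF n] _ _ _ _ _ \<epsilon>(2)[OF n] _ _ _ v E])
    show "is_cond_exp M (past_algebra M w n) (BB n) (\<lambda>\<omega>. B (w n \<omega>))" using cond1 n by blast
    show "rand_var (past_algebra M w n) (w n)" using n w_rv[OF n] by (intro rand_var_past_algebra) auto
    show "AE \<omega> in M. nn_cond_exp M (past_algebra M w n) (\<lambda>\<omega>. ennreal ((norm (BB n \<omega> - B (w n \<omega>)))\<^sup>2)) \<omega>
           \<le> ennreal (\<sigma>\<^sup>2 * (1 + \<alpha> n * (norm (B (w n \<omega>)))\<^sup>2))" using cond2(3) n by blast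
  qed (use w_rv[OF n] w_rv[of "Suc n"] BB[OF n] w_Suc[OF n] in auto)

  have fejer: "stoch_quasi_Fejer M w (zer_sum A B)"
    unfolding stoch_quasi_Fejer_def
  proof (intro conjI exI[of _ c] ballI allI impI)
    show "random_process M w"
      unfolding random_process_def
    proof (intro allI impI Bochner_integral_exists)
      fix n :: nat assume n: "1 \<le> n"
      then show rv: "rand_var M (w n)" using w_rv by blast
      have "(\<integral>\<^sup>+\<omega>. norm (w n \<omega>) \<partial>M) \<le> (\<integral>\<^sup>+\<omega>. ennreal (1 + (norm (w n \<omega>))\<^sup>2) \<partial>M)"
      proof (intro nn_integral_mono ennreal_leI)
        fix \<omega>
        have "2 * norm (w n \<omega>) \<le> 1 + (norm (w n \<omega>))\<^sup>2"
          using sum_squares_bound[of 1 "norm (w n \<omega>)"] by simp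
        with norm_ge_zero[of "w n \<omega>"] show "norm (w n \<omega>) \<le> 1 + (norm (w n \<omega>))\<^sup>2" by linarith
      qed
      also have "\<dots> = ennreal (\<integral>\<omega>. 1 + (norm (w n \<omega>))\<^sup>2 \<partial>M)"
        using dist_int[OF n, of 0] by (intro nn_integral_eq_integral) auto
      also have "\<dots> < \<infinity>" by simp
      finally show "(\<integral>\<^sup>+\<omega>. norm (w n \<omega>) \<partial>M) < \<infinity>" .
    qed
    fix v and n :: nat assume v: "v \<in> zer_sum A B" and n: "1 \<le> n"
    interpret finite_measure_subalgebra M "past_algebra M w n" by unfold_locales (rule sub[OF n])
    show "AE \<omega> in M. nn_cond_exp M (past_algebra M w n) (\<lambda>\<omega>. ennreal ((norm (w (Suc n) \<omega> - v))\<^sup>2)) \<omega>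
       \<le> ennreal ((norm (w n \<omega> - v))\<^sup>2 + c n)"
    proof (rule nn_cond_exp_leI)
      fix E assume E: "E \<in> sets (past_algebra M w n)"
      have EM: "E \<in> sets M" using E sub[OF n] by (auto simp: subalgebra_def)
      have "(\<integral>\<omega>. indicator E \<omega> * ((norm (w n \<omega> - v))\<^sup>2 - \<epsilon> * G v n \<omega> + c n) \<partial>M)
         \<le> (\<integral>\<omega>. indicator E \<omega> * ((norm (w n \<omega> - v))\<^sup>2 + c n) \<partial>M)"
      proof (rule integral_mono)
        show "integrable M (\<lambda>\<omega>. indicator E \<omega> * ((norm (w n \<omega> - v))\<^sup>2 - \<epsilon> * G v n \<omega> + c n))"
          using integrable_mult_indicator[OF EM, of "\<lambda>\<omega>. (norm (w n \<omega> - v))\<^sup>2 - \<epsilon> * G v n \<omega> + c n"]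
            dist_int[OF n] G_int[OF n] by simp
        show "integrable M (\<lambda>\<omega>. indicator E \<omega> * ((norm (w n \<omega> - v))\<^sup>2 + c n))"
          using integrable_mult_indicator[OF EM, of "\<lambda>\<omega>. (norm (w n \<omega> - v))\<^sup>2 + c n"]
            dist_int[OF n] by simp
        show "indicator E \<omega> * ((norm (w n \<omega> - v))\<^sup>2 - \<epsilon> * G v n \<omega> + c n)
            \<le> indicator E \<omega> * ((norm (w n \<omega> - v))\<^sup>2 + c n)" for \<omega>
          using G0[OF n, of v \<omega>] \<epsilon>(1) by (intro mult_left_mono) auto
      qed
      with step[OF n v E] show "(\<integral>\<omega>. indicator E \<omega> * (norm (w (Suc n) \<omega> - v))\<^sup>2 \<partial>M)
         \<le> (\<integral>\<omega>. indicator E \<omega> * ((norm (w n \<omega> - v))\<^sup>2 + c n) \<partial>M)" by linarith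
    qed (use n c0[OF n] dist_int[OF n] dist_int[of "Suc n"] dist_meas[OF n] in auto)
  qed (use assms(5,12) c0 c_sum in auto)

  \<comment> \<open>the process starts at index \<open>1\<close>; the shift adapts it to filtrations indexed from \<open>0\<close>\<close>
  define F where "F n = past_algebra M w (Suc n)" for n
  obtain \<zeta> where \<zeta>: "integrable M \<zeta>" "AE \<omega> in M. (\<lambda>n. (norm (w (Suc n) \<omega> - wbar))\<^sup>2) \<longlonglongrightarrow> \<zeta> \<omega>"
    and gap_sum: "AE \<omega> in M. summable (\<lambda>n. \<epsilon> * G wbar (Suc n) \<omega>)"
  proof (rule robbins_siegmund[of F "\<lambda>n \<omega>. (norm (w (Suc n) \<omega> - wbar))\<^sup>2" "\<lambda>n \<omega>. \<epsilon> * G wbar (Suc n) \<omega>" "\<lambda>n. c (Suc n)"])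
    show "subalgebra M (F n)" for n unfolding F_def by (rule sub) simp
    show "sets (F n) \<subseteq> sets (F (Suc n))" for n unfolding F_def by (rule past_algebra_mono) simp
    show "(\<lambda>\<omega>. (norm (w (Suc n) \<omega> - wbar))\<^sup>2) \<in> borel_measurable (F n)" for n
      unfolding F_def by (rule dist_meas) simp
    show "(\<integral>\<omega>. indicator E \<omega> * (norm (w (Suc (Suc n)) \<omega> - wbar))\<^sup>2 \<partial>M)
      \<le> (\<integral>\<omega>. indicator E \<omega> * ((norm (w (Suc n) \<omega> - wbar))\<^sup>2 - \<epsilon> * G wbar (Suc n) \<omega> + c (Suc n)) \<partial>M)"
      if "E \<in> sets (F n)" for n E
      using step[OF _ wbar] that by (simp add: F_def)
  qed (use dist_int G_int G0 c0 c_sum \<epsilon>(1) in auto)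

  have not_summable: "\<not> summable (\<lambda>n. lam (Suc n) * \<gamma> (Suc n))"
  proof
    assume "summable (\<lambda>n. lam (Suc n) * \<gamma> (Suc n))"
    then have "(\<lambda>N. \<Sum>n<N. lam (Suc n) * \<gamma> (Suc n)) \<longlonglongrightarrow> (\<Sum>n. lam (Suc n) * \<gamma> (Suc n))"
      by (rule summable_LIMSEQ)
    moreover have "(\<Sum>n=1..N. lam n * \<gamma> n) = (\<Sum>n<N. lam (Suc n) * \<gamma> (Suc n))" for N
      by (simp add: sum.atLeast1_atMost_eq)
    ultimately show False
      using cond4(1) not_tendsto_and_filterlim_at_infinity[OF sequentially_bot] filterlim_at_top_imp_at_infinity
      by simp blast
  qed
  have good: "AE \<omega> in M. (\<lambda>n. (norm (w (Suc n) \<omega> - wbar))\<^sup>2) \<longlonglongrightarrow> \<zeta> \<omega> \<and>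
     (\<exists>t. strict_mono t \<and> (\<lambda>n. inner (w (Suc (t n)) \<omega> - wbar) (B (w (Suc (t n)) \<omega>) - B wbar)) \<longlonglongrightarrow> 0)"
    using \<zeta>(2) gap_sum
  proof eventually_elim
    case (elim \<omega>)
    let ?g = "\<lambda>n. inner (w (Suc n) \<omega> - wbar) (B (w (Suc n) \<omega>) - B wbar)"
    have "summable (\<lambda>n. (lam (Suc n) * \<gamma> (Suc n)) * ?g n)"
      using elim(2) \<epsilon>(1) by (simp add: G_def)
    moreover have "0 \<le> lam (Suc n) * \<gamma> (Suc n)" for n
      using lam[of "Suc n"] \<gamma>[of "Suc n"] by simp
    ultimately obtain t where "strict_mono t" "(\<lambda>n. ?g (t n)) \<longlonglongrightarrow> 0"
      using weighted_summable_imp_null_subsequence[OF _ not_summable, of ?g]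
        cocoercive_inner_nonneg[OF \<beta> B] by blast
    with elim(1) show ?case by blast
  qed

  have lim: "AE \<omega> in M. (\<lambda>n. (norm (w n \<omega> - wbar))\<^sup>2) \<longlonglongrightarrow> \<zeta> \<omega>"
    using \<zeta>(2) by eventually_elim (rule LIMSEQ_imp_Suc)

  have strong: "AE \<omega> in M. (\<lambda>n. w n \<omega>) \<longlonglongrightarrow> wbar" if um: "uniformly_monotone_at B wbar"
    using good
  proof eventually_elim
    case (elim \<omega>)
    then obtain t where t: "strict_mono t"
        "(\<lambda>n. inner (w (Suc (t n)) \<omega> - wbar) (B (w (Suc (t n)) \<omega>) - B wbar)) \<longlonglongrightarrow> 0" by blast
    have "(\<lambda>n. w (Suc (t n)) \<omega>) \<longlonglongrightarrow> wbar"
      by (rule uniformly_monotone_at_tendsto[OF um t(2)])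
    then have "(\<lambda>n. (norm (w (Suc (t n)) \<omega> - wbar))\<^sup>2) \<longlonglongrightarrow> (norm (wbar - wbar))\<^sup>2"
      by (intro tendsto_intros)
    moreover have "(\<lambda>n. (norm (w (Suc (t n)) \<omega> - wbar))\<^sup>2) \<longlonglongrightarrow> \<zeta> \<omega>"
      using LIMSEQ_subseq_LIMSEQ[OF conjunct1[OF elim] t(1)] by (simp add: comp_def)
    ultimately have "(norm (wbar - wbar))\<^sup>2 = \<zeta> \<omega>" by (rule LIMSEQ_unique)
    then have "\<zeta> \<omega> = 0" by simp
    with conjunct1[OF elim] have "(\<lambda>n. (norm (w (Suc n) \<omega> - wbar))\<^sup>2) \<longlonglongrightarrow> 0" by simp
    then have "(\<lambda>n. norm (w (Suc n) \<omega> - wbar)) \<longlonglongrightarrow> 0"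
      using tendsto_real_sqrt[of "\<lambda>n. (norm (w (Suc n) \<omega> - wbar))\<^sup>2" 0] by simp
    then have "(\<lambda>n. w (Suc n) \<omega>) \<longlonglongrightarrow> wbar"
      by (simp add: tendsto_norm_zero_iff LIM_zero_iff)
    then show ?case by (rule LIMSEQ_imp_Suc)
  qed

  have weak: "\<exists>\<Omega>1\<in>sets M. measure M \<Omega>1 = 1 \<and>
            (\<forall>\<omega>\<in>\<Omega>1. \<exists>t :: nat \<Rightarrow> nat. strict_mono t \<and> (\<forall>n. t n \<ge> 1) \<and>
               weakly_converges (\<lambda>n. w (t n) \<omega>) wbar)"
    if sm: "strictly_monotone_at B wbar" and wc: "weakly_continuous B"
  proof -
    obtain N where N:
      "\<And>\<omega>. \<omega> \<in> space M - N \<Longrightarrow> (\<lambda>n. (norm (w (Suc n) \<omega> - wbar))\<^sup>2) \<longlonglongrightarrow> \<zeta> \<omega> \<and>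
       (\<exists>t. strict_mono t \<and> (\<lambda>n. inner (w (Suc (t n)) \<omega> - wbar) (B (w (Suc (t n)) \<omega>) - B wbar)) \<longlonglongrightarrow> 0)"
      "N \<in> null_sets M"
      by (rule AE_E3[OF good]) (rule that)
    have "\<exists>t :: nat \<Rightarrow> nat. strict_mono t \<and> (\<forall>n. t n \<ge> 1) \<and> weakly_converges (\<lambda>n. w (t n) \<omega>) wbar"
      if \<omega>: "\<omega> \<in> space M - N" for \<omega>
    proof -
      obtain t where t: "strict_mono t"
        "(\<lambda>n. inner (w (Suc (t n)) \<omega> - wbar) (B (w (Suc (t n)) \<omega>) - B wbar)) \<longlonglongrightarrow> 0"
        using N(1)[OF \<omega>] by blast
      have "Bseq (\<lambda>n. (norm (w (Suc n) \<omega> - wbar))\<^sup>2)"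
        using N(1)[OF \<omega>] by (intro convergent_imp_Bseq) (auto simp: convergent_def)
      then obtain K where K: "0 < K" "\<And>n. (norm (w (Suc n) \<omega> - wbar))\<^sup>2 \<le> K"
        by (auto simp: Bseq_def)
      have bounded: "norm (w (Suc n) \<omega>) \<le> sqrt K + norm wbar" for n
        using real_le_rsqrt[OF K(2)[of n]] norm_triangle_sub[of "w (Suc n) \<omega>" wbar] by linarith
      obtain r where r: "strict_mono r" "weakly_converges (\<lambda>n. w (Suc (t (r n))) \<omega>) wbar"
        by (rule strictly_monotone_at_weakly_convergent_subsequence[OF \<beta> B sm wc bounded t(2)])
      show ?thesis
        using r strict_mono_o[OF t(1) r(1)]
        by (intro exI[of _ "\<lambda>n. Suc (t (r n))"]) (auto simp: strict_mono_def)
    qed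
    moreover have "measure M (space M - N) = 1"
      using N(2) by (subst prob_compl) (auto simp: null_sets_def measure_def)
    moreover have "space M - N \<in> sets M" using N(2) by auto
    ultimately show ?thesis by blast
  qed
  show ?thesis using fejer \<zeta>(1) lim strong weak by blast
qed

end
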